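(* Let $S_x,S_y\subset\mathbb{R}^3$ be non-degenerate flat triangles with $S_x\cap S_y=\emptyset$ whose unit normals satisfy $|\mathbf{n}_x\cdot\mathbf{n}_y|\neq1$ (the planes of the triangles are not parallel). Let $G(\mathbf{x},\mathbf{y})=1/|\mathbf{x}-\mathbf{y}|$ and $$L=\int_{S_y}\int_{S_x}G\,dS(\mathbf{x})dS(\mathbf{y}),\quad M=\int_{S_y}\int_{S_x}\mathbf{n}_x\cdot\nabla_{\mathbf{x}}G\,dS(\mathbf{x})dS(\mathbf{y}),\quad \mathbf{L}'=\int_{S_y}\nabla_{\mathbf{y}}\int_{S_x}G\,dS(\mathbf{x})dS(\mathbf{y}).$$ With the six prism integrals $J_1,\dots,J_6$ and the notation of the context, put $$\mathbf{F}_y=\sum_{i=1}^3\mathbf{n}_{cyi}\,2l_{yi}A_xJ_i,\qquad \mathbf{F}_x=\sum_{i=1}^3\mathbf{n}_{cxi}\,2l_{xi}A_yJ_{i+3}.$$ Then $$M=-\frac{\mathbf{n}_x\cdot\mathbf{F}_y-(\mathbf{n}_x\cdot\mathbf{n}_y)\,\mathbf{n}_y\cdot\mathbf{F}_x}{1-(\mathbf{n}_x\cdot\mathbf{n}_y)^2},\qquad \mathbf{L}'=-\mathbf{F}_x-\mathbf{n}_xM,$$ and the single layer integral is expressed through the same six integrals: for any reals $s_{10},\dots,s_{40}$ with $\mathbf{x}_1-\mathbf{y}_1=\sum_{i=1}^4s_{i0}\mathbf{a}_i$ (such reals exist), $$L=\frac{4A_xA_y}{3}\Big[-s_{40}J_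1+(1+s_{30}+s_{40})J_2-s_{30}J_3-s_{20}J_4+(1+s_{10}+s_{20})J_5-s_{10}J_6\Big].$$
   Context: $S_x$ has vertices $\mathbf{x}_1,\mathbf{x}_2,\mathbf{x}_3$ and area $A_x$; $\mathbf{l}_{x1}=\mathbf{x}_2-\mathbf{x}_1$, $\mathbf{l}_{x2}=\mathbf{x}_3-\mathbf{x}_2$, $\mathbf{l}_{x3}=\mathbf{x}_1-\mathbf{x}_3$, $l_{xi}=|\mathbf{l}_{xi}|$, $\mathbf{n}_x=-(\mathbf{l}_{x1}\times\mathbf{l}_{x3})/(2A_x)$, $\mathbf{n}_{cxi}=(\mathbf{l}_{xi}\times\mathbf{n}_x)/l_{xi}$ (outer normal to the $i$-th edge in the plane of $S_x$). The same notation with $y$ in place of $x$ is used for $S_y$. Put $\mathbf{a}_1=\mathbf{x}_2-\mathbf{x}_1$, $\mathbf{a}_2=\mathbf{x}_3-\mathbf{x}_1$, $\mathbf{a}_3=-(\mathbf{y}_2-\mathbf{y}_1)$, $\mathbf{a}_4=-(\mathbf{y}_3-\mathbf{y}_1)$, $\mathbf{e}=\mathbf{x}_1-\mathbf{y}_1$. For vectors $\mathbf{b}_1,\mathbf{b}_2,\mathbf{b}_3,\mathbf{f}\in\mathbb{R}^3$ let $$J(\mathbf{b}_1,\mathbf{b}_2,\mathbf{b}_3;\mathbf{f})=\int_0^1\int_0^{1-s_1}\int_0^1\frac{ds_3\,ds_2\,ds_1}{|\mathbf{b}_1s_1+\mathbf{b}_2s_2+\mathbf{b}_3s_3+\mathbf{f}|},$$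 and set $$J_1=J(\mathbf{a}_1,\mathbf{a}_2,\mathbf{a}_3;\mathbf{e}),\quad J_2=J(\mathbf{a}_1,\mathbf{a}_2,\mathbf{a}_4-\mathbf{a}_3;\mathbf{e}+\mathbf{a}_3),\quad J_3=J(\mathbf{a}_1,\mathbf{a}_2,\mathbf{a}_4;\mathbf{e}),$$ $$J_4=J(\mathbf{a}_3,\mathbf{a}_4,\mathbf{a}_1;\mathbf{e}),\quad J_5=J(\mathbf{a}_3,\mathbf{a}_4,\mathbf{a}_2-\mathbf{a}_1;\mathbf{e}+\mathbf{a}_1),\quad J_6=J(\mathbf{a}_3,\mathbf{a}_4,\mathbf{a}_2;\mathbf{e}).$$ *)

theory Defs
  imports "HOL-Analysis.Analysis"
begin

text \<open>A triangle is given by its vertices \<open>v 1, v 2, v 3\<close>; other values of \<open>v\<close> are irrelevant.\<close>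

definition flat_triangle :: "(nat \<Rightarrow> real^3) \<Rightarrow> (real^3) set" where
  "flat_triangle v = convex hull {v 1, v 2, v 3}"

definition surface_integral ::
    "(real \<times> real) set \<Rightarrow> (real \<times> real \<Rightarrow> real^3) \<Rightarrow>
     (real^3 \<Rightarrow> 'a::{banach, second_countable_topology}) \<Rightarrow> 'a" where
  "surface_integral D \<phi> f =
     (LINT u:D|lborel.
        norm (cross3 (frechet_derivative \<phi> (at u) (1, 0)) (frechet_derivative \<phi> (at u) (0, 1)))
          *\<^sub>R f (\<phi> u))"

definition simplex2 :: "(real \<times> real) set" where
  "simplex2 = {(s, t). 0 \<le> s \<and> 0 \<le> t \<and> s + t \<le> 1}"

definition tri_param :: "(nat \<Rightarrow> real^3) \<Rightarrow> real \<times> real \<Rightarrow> real^3" where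
  "tri_param v = (\<lambda>(s, t). v 1 + s *\<^sub>R (v 2 - v 1) + t *\<^sub>R (v 3 - v 1))"

lemma tri_param_image: "tri_param v ` simplex2 = flat_triangle v"
  unfolding flat_triangle_def convex_hull_3_alt simplex2_def tri_param_def
  by (auto simp: image_iff)

definition tri_integral ::
    "(nat \<Rightarrow> real^3) \<Rightarrow> (real^3 \<Rightarrow> 'a::{banach, second_countable_topology}) \<Rightarrow> 'a" where
  "tri_integral v f = surface_integral simplex2 (tri_param v) f"

definition tri_area :: "(nat \<Rightarrow> real^3) \<Rightarrow> real" where
  "tri_area v = tri_integral v (\<lambda>_. 1)"

text \<open>For \<open>i = 1, 2, 3\<close> the index \<open>i mod 3 + 1\<close> is the cyclic successor of \<open>i\<close>.\<close>

definition tri_edge :: "(nat \<Rightarrow> real^3) \<Rightarrow> nat \<Rightarrow> real^3" where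
  "tri_edge v i = v (i mod 3 + 1) - v i"

definition tri_normal :: "(nat \<Rightarrow> real^3) \<Rightarrow> real^3" where
  "tri_normal v = - (1 / (2 * tri_area v)) *\<^sub>R cross3 (tri_edge v 1) (tri_edge v 3)"

definition edge_normal :: "(nat \<Rightarrow> real^3) \<Rightarrow> nat \<Rightarrow> real^3" where
  "edge_normal v i = (1 / norm (tri_edge v i)) *\<^sub>R cross3 (tri_edge v i) (tri_normal v)"

text \<open>Only meaningful at points where \<open>f\<close> is differentiable.\<close>

definition gradient :: "('a::real_inner \<Rightarrow> real) \<Rightarrow> 'a \<Rightarrow> 'a" where
  "gradient f p = (THE D. GDERIV f p :> D)"

definition green :: "real^3 \<Rightarrow> real^3 \<Rightarrow> real" where
  "green p q = 1 / norm (p - q)"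

definition single_layer :: "(nat \<Rightarrow> real^3) \<Rightarrow> (nat \<Rightarrow> real^3) \<Rightarrow> real" where
  "single_layer x y = tri_integral y (\<lambda>q. tri_integral x (\<lambda>p. green p q))"

definition double_layer :: "(nat \<Rightarrow> real^3) \<Rightarrow> (nat \<Rightarrow> real^3) \<Rightarrow> real" where
  "double_layer x y =
     tri_integral y (\<lambda>q. tri_integral x (\<lambda>p. tri_normal x \<bullet> gradient (\<lambda>p'. green p' q) p))"

definition single_layer_grad :: "(nat \<Rightarrow> real^3) \<Rightarrow> (nat \<Rightarrow> real^3) \<Rightarrow> real^3" where
  "single_layer_grad x y =
     tri_integral y (\<lambda>q. gradient (\<lambda>q'. tri_integral x (\<lambda>p. green p q')) q)"

definition prism_integral :: "real^3 \<Rightarrow> real^3 \<Rightarrow> real^3 \<Rightarrow> real^3 \<Rightarrow> real" where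
  "prism_integral b1 b2 b3 f =
     (LINT s1:{0..1}|lborel. LINT s2:{0..1 - s1}|lborel. LINT s3:{0..1}|lborel.
        1 / norm (s1 *\<^sub>R b1 + s2 *\<^sub>R b2 + s3 *\<^sub>R b3 + f))"

end

theory Submission
  imports Defs
begin

text \<open>
  Write \<open>r = e + s\<^sub>1a\<^sub>1 + s\<^sub>2a\<^sub>2 + s\<^sub>3a\<^sub>3 + s\<^sub>4a\<^sub>4\<close> for the difference of the two points in
  barycentric coordinates. The vector \<open>W = \<integral>\<integral> r / |r|\<^sup>3\<close> carries both \<open>M\<close> and \<open>L'\<close>. Since
  \<open>1 / |r|\<close> has derivative \<open>- a\<^sub>i \<bullet> r / |r|\<^sup>3\<close> in \<open>s\<^sub>i\<close>, integrating over the parameter triangles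
  expresses each \<open>a\<^sub>i \<bullet> W\<close> as a difference of two prism integrals; this fixes the component of
  \<open>W\<close> tangential to each triangle, and as the planes are not parallel it fixes \<open>W\<close>.
  For \<open>L = 4 A\<^sub>x A\<^sub>y I\<close> with \<open>I = \<integral>\<integral> 1 / |r|\<close>, integrate the divergence of \<open>(s\<^sub>1, s\<^sub>2, s\<^sub>3, s\<^sub>4) / |r|\<close>:
  only the two hypotenuses contribute, and \<open>r \<bullet> r / |r|\<^sup>3 = 1 / |r|\<close> turns the result
  into \<open>3 I + e \<bullet> W = J\<^sub>2 + J\<^sub>5\<close>.
\<close>

section \<open>Integrals over compact sets and the parameter triangle\<close>

text \<open>A continuous function on a compact product, extended by zero, is integrable for the
  product measure, so Fubini gives both claims. Every interchange and every inner integral below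
  rests on this.\<close>

lemma
  fixes f :: "'a::euclidean_space \<times> 'b::euclidean_space \<Rightarrow> 'c::{banach, second_countable_topology}"
  assumes "compact A" "compact B" "continuous_on (A \<times> B) f"
  shows set_integrable_compact_inner: "set_integrable lborel A (\<lambda>a. LINT b:B|lborel. f (a, b))"
    and set_integral_compact_swap:
      "(LINT a:A|lborel. LINT b:B|lborel. f (a, b)) = (LINT b:B|lborel. LINT a:A|lborel. f (a, b))"
proof -
  define g where "g = (\<lambda>z. indicator (A \<times> B) z *\<^sub>R f z)"
  have int: "integrable (lborel \<Otimes>\<^sub>M lborel) g"
    using borel_integrable_compact[OF compact_Times[OF assms(1,2)] assms(3)]
    by (simp add: lborel_prod g_def)
  have g: "g (a, b) = indicator A a *\<^sub>R indicator B b *\<^sub>R f (a, b)" for a b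
    by (simp add: g_def indicator_times)
  have g': "g (a, b) = indicator B b *\<^sub>R indicator A a *\<^sub>R f (a, b)" for a b
    unfolding g by (rule scaleR_left_commute)
  show "set_integrable lborel A (\<lambda>a. LINT b:B|lborel. f (a, b))"
    using lborel_pair.integrable_fst'[OF int]
    by (simp add: g set_integrable_def set_lebesgue_integral_def del: scaleR_scaleR)
  have "(LINT a|lborel. LINT b|lborel. g (a, b)) = (LINT b|lborel. LINT a|lborel. g (a, b))"
    using lborel_pair.Fubini_integral[of "\<lambda>a b. g (a, b)"] int by simp
  moreover have "(LINT a|lborel. g (a, b)) = indicator B b *\<^sub>R (LINT a:A|lborel. f (a, b))" for b
    by (simp add: g' set_lebesgue_integral_def del: scaleR_scaleR)
  ultimately show "(LINT a:A|lborel. LINT b:B|lborel. f (a, b)) = (LINT b:B|lborel. LINT a:A|lborel. f (a, b))"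
    by (simp add: g set_lebesgue_integral_def del: scaleR_scaleR)
qed

lemma set_integrable_compact:
  fixes f :: "'a::euclidean_space \<Rightarrow> 'b::{banach, second_countable_topology}"
  assumes "compact S" "continuous_on S f"
  shows "set_integrable lborel S f"
  unfolding set_integrable_def by (rule borel_integrable_compact[OF assms])

lemma set_integral_inner_right:
  fixes f :: "'a \<Rightarrow> 'b::{real_inner, banach, second_countable_topology}"
  assumes "set_integrable M A f"
  shows "set_integrable M A (\<lambda>x. c \<bullet> f x)" "(LINT x:A|M. c \<bullet> f x) = c \<bullet> (LINT x:A|M. f x)"
proof -
  have "integrable M (\<lambda>x. c \<bullet> (indicator A x *\<^sub>R f x))"
    using assms unfolding set_integrable_def by (intro integrable_inner_right)
  then show "set_integrable M A (\<lambda>x. c \<bullet> f x)"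
    by (simp add: set_integrable_def)
  have "(LINT x|M. c \<bullet> (indicator A x *\<^sub>R f x)) = c \<bullet> (LINT x|M. indicator A x *\<^sub>R f x)"
    using assms unfolding set_integrable_def by (intro integral_inner_right)
  then show "(LINT x:A|M. c \<bullet> f x) = c \<bullet> (LINT x:A|M. f x)"
    by (simp add: set_lebesgue_integral_def)
qed

lemma compact_simplex2: "compact simplex2"
proof -
  have eq: "simplex2 = ({0..1} \<times> {0..1}) \<inter> {z. fst z + snd z \<le> 1}"
    by (auto simp: simplex2_def)
  show ?thesis
    unfolding eq
    by (intro compact_Int_closed compact_Times compact_Icc closed_Collect_le continuous_intros)
qed

lemma simplex2_in_sets [measurable, simp]: "simplex2 \<in> sets borel"
  by (simp add: borel_closed compact_imp_closed compact_simplex2)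

text \<open>The indicator of the triangle factors into that of \<open>{0..1}\<close> in one variable
  and that of a slice in the other, so both orders follow from Fubini. The first order is the one in
  \<open>prism_integral\<close>.\<close>

lemma
  fixes g :: "real \<times> real \<Rightarrow> 'a::{banach, second_countable_topology}"
  assumes "set_integrable lborel simplex2 g"
  shows simplex2_integral_fst:
      "(LINT p:simplex2|lborel. g p) = (LINT s:{0..1}|lborel. LINT t:{0..1 - s}|lborel. g (s, t))"
    and simplex2_integral_snd:
      "(LINT p:simplex2|lborel. g p) = (LINT t:{0..1}|lborel. LINT s:{0..1 - t}|lborel. g (s, t))"
proof -
  define h where "h = (\<lambda>p. indicator simplex2 p *\<^sub>R g p)"
  have int: "integrable (lborel \<Otimes>\<^sub>M lborel) h"
    using assms by (simp add: set_integrable_def lborel_prod h_def)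
  have h1: "h (s, t) = indicator {0..1} s *\<^sub>R indicator {0..1 - s} t *\<^sub>R g (s, t)" for s t
    by (auto simp: h_def simplex2_def indicator_def)
  have h2: "h (s, t) = indicator {0..1} t *\<^sub>R indicator {0..1 - t} s *\<^sub>R g (s, t)" for s t
    by (auto simp: h_def simplex2_def indicator_def)
  have "(LINT p|lborel. h p) = (LINT s|lborel. LINT t|lborel. h (s, t))"
    using lborel_pair.integral_fst'[OF int] by (simp add: lborel_prod)
  then show "(LINT p:simplex2|lborel. g p) = (LINT s:{0..1}|lborel. LINT t:{0..1 - s}|lborel. g (s, t))"
    by (simp only: h1) (simp add: h_def set_lebesgue_integral_def del: scaleR_scaleR)
  have "(LINT p|lborel. h p) = (LINT t|lborel. LINT s|lborel. h (s, t))"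
    using lborel_pair.integral_snd[of "\<lambda>s t. h (s, t)"] int by (simp add: lborel_prod)
  then show "(LINT p:simplex2|lborel. g p) = (LINT t:{0..1}|lborel. LINT s:{0..1 - t}|lborel. g (s, t))"
    by (simp only: h2) (simp add: h_def set_lebesgue_integral_def del: scaleR_scaleR)
qed

lemma set_integral_FTC_Icc:
  fixes f :: "real \<Rightarrow> real"
  assumes "a \<le> b" "\<And>x. x \<in> {a..b} \<Longrightarrow> (F has_real_derivative f x) (at x)" "continuous_on {a..b} f"
  shows "(LINT x:{a..b}|lborel. f x) = F b - F a"
  unfolding set_lebesgue_integral_def
  by (rule integral_FTC_Icc[OF assms(1) _ assms(3)])
     (auto simp: has_real_derivative_iff_has_vector_derivative[symmetric] intro!: has_field_derivative_at_within assms(2))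

lemma simplex2_measure: "(LINT p:simplex2|lborel. (1::real)) = 1 / 2"
proof -
  have "(LINT p:simplex2|lborel. (1::real)) = (LINT s:{0..1::real}|lborel. LINT t:{0..1 - s}|lborel. (1::real))"
    by (rule simplex2_integral_fst[where g = "\<lambda>_. 1"]) (intro set_integrable_compact compact_simplex2 continuous_intros)
  also have "\<dots> = (LINT s:{0..1::real}|lborel. 1 - s)"
  proof (rule set_lebesgue_integral_cong, simp, intro allI impI)
    fix s :: real assume "s \<in> {0..1}"
    then show "(LINT t:{0..1 - s}|lborel. (1::real)) = 1 - s"
      by (subst set_integral_FTC_Icc[where F = "\<lambda>t. t"]) (auto intro!: continuous_intros derivative_eq_intros)
  qed
  also have "\<dots> = 1 / 2"
    by (subst set_integral_FTC_Icc[where F = "\<lambda>s. s - s\<^sup>2 / 2"])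
       (auto intro!: continuous_intros derivative_eq_intros)
  finally show ?thesis .
qed

text \<open>This is the divergence theorem one coordinate at a time: on each slice the fundamental
  theorem of calculus leaves an upper end on the hypotenuse and a lower end on a leg.\<close>

lemma
  fixes f f' :: "real \<times> real \<Rightarrow> real"
  assumes cont: "continuous_on simplex2 f" "continuous_on simplex2 f'"
  shows simplex2_integral_deriv_fst:
    "(\<And>s t. (s, t) \<in> simplex2 \<Longrightarrow> ((\<lambda>s. f (s, t)) has_real_derivative f' (s, t)) (at s)) \<Longrightarrow>
     (LINT p:simplex2|lborel. f' p) =
       (LINT t:{0..1}|lborel. f (1 - t, t)) - (LINT t:{0..1}|lborel. f (0, t))"
    and simplex2_integral_deriv_snd:
    "(\<And>s t. (s, t) \<in> simplex2 \<Longrightarrow> ((\<lambda>t. f (s, t)) has_real_derivative f' (s, t)) (at t)) \<Longrightarrow>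
     (LINT p:simplex2|lborel. f' p) =
       (LINT s:{0..1}|lborel. f (s, 1 - s)) - (LINT s:{0..1}|lborel. f (s, 0))"
proof -
  note int = set_integrable_compact[OF compact_simplex2 cont(2)]
  have comp: "continuous_on S (\<lambda>z. g (h z, k z))"
    if "continuous_on simplex2 g" "continuous_on S h" "continuous_on S k" "\<And>z. z \<in> S \<Longrightarrow> (h z, k z) \<in> simplex2"
    for g :: "real \<times> real \<Rightarrow> real" and S :: "real set" and h k
    using that by (intro continuous_on_compose2[OF that(1)] continuous_intros) auto
  have Icc: "set_integrable lborel {0..1} (\<lambda>t::real. f (h t, k t))"
    if "continuous_on {0..1} h" "continuous_on {0..1} k" "\<And>t. t \<in> {0..1} \<Longrightarrow> (h t, k t) \<in> simplex2" for h k
    by (intro set_integrable_compact comp cont that) auto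
  {
    assume d: "\<And>s t. (s, t) \<in> simplex2 \<Longrightarrow> ((\<lambda>s. f (s, t)) has_real_derivative f' (s, t)) (at s)"
    have "(LINT p:simplex2|lborel. f' p) = (LINT t:{0..1}|lborel. LINT s:{0..1 - t}|lborel. f' (s, t))"
      by (rule simplex2_integral_snd[OF int])
    also have "\<dots> = (LINT t:{0..1}|lborel. f (1 - t, t) - f (0, t))"
    proof (rule set_lebesgue_integral_cong, simp, intro allI impI)
      fix t :: real assume "t \<in> {0..1}"
      then show "(LINT s:{0..1 - t}|lborel. f' (s, t)) = f (1 - t, t) - f (0, t)"
        by (intro set_integral_FTC_Icc[where F = "\<lambda>s. f (s, t)"] d comp[OF cont(2)] continuous_intros)
           (auto simp: simplex2_def)
    qed
    also have "\<dots> = (LINT t:{0..1}|lborel. f (1 - t, t)) - (LINT t:{0..1}|lborel. f (0, t))"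
      by (intro set_integral_diff Icc continuous_intros) (auto simp: simplex2_def)
    finally show "(LINT p:simplex2|lborel. f' p) =
       (LINT t:{0..1}|lborel. f (1 - t, t)) - (LINT t:{0..1}|lborel. f (0, t))" .
  }
  {
    assume d: "\<And>s t. (s, t) \<in> simplex2 \<Longrightarrow> ((\<lambda>t. f (s, t)) has_real_derivative f' (s, t)) (at t)"
    have "(LINT p:simplex2|lborel. f' p) = (LINT s:{0..1}|lborel. LINT t:{0..1 - s}|lborel. f' (s, t))"
      by (rule simplex2_integral_fst[OF int])
    also have "\<dots> = (LINT s:{0..1}|lborel. f (s, 1 - s) - f (s, 0))"
    proof (rule set_lebesgue_integral_cong, simp, intro allI impI)
      fix s :: real assume "s \<in> {0..1}"
      then show "(LINT t:{0..1 - s}|lborel. f' (s, t)) = f (s, 1 - s) - f (s, 0)"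
        by (intro set_integral_FTC_Icc[where F = "\<lambda>t. f (s, t)"] d comp[OF cont(2)] continuous_intros)
           (auto simp: simplex2_def)
    qed
    also have "\<dots> = (LINT s:{0..1}|lborel. f (s, 1 - s)) - (LINT s:{0..1}|lborel. f (s, 0))"
      by (intro set_integral_diff Icc continuous_intros) (auto simp: simplex2_def)
    finally show "(LINT p:simplex2|lborel. f' p) =
       (LINT s:{0..1}|lborel. f (s, 1 - s)) - (LINT s:{0..1}|lborel. f (s, 0))" .
  }
qed

section \<open>Fluxes of the Coulomb field\<close>

text \<open>Serves to bring the two directions in which the hypotenuse is traversed to a common
  one.\<close>

lemma set_integral_reflect_01:
  fixes g :: "real \<Rightarrow> 'a::{banach, second_countable_topology}"
  shows "(LINT s:{0..1}|lborel. g (1 - s)) = (LINT s:{0..1}|lborel. g s)"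
proof -
  have "(indicator {0..1} (1 - s) :: real) = indicator {0..1} s" for s :: real
    by (auto simp: indicator_def)
  then show ?thesis
    unfolding set_lebesgue_integral_def
    using lborel_integral_real_affine[of "-1" "\<lambda>s. indicator {0..1} s *\<^sub>R g s" 1] by simp
qed

text \<open>The negative gradient of \<open>1 / norm w\<close> away from the origin; at the origin
  its value is 0.\<close>

definition coulomb_field :: "'a::real_inner \<Rightarrow> 'a" where
  "coulomb_field w = (1 / norm w ^ 3) *\<^sub>R w"

text \<open>Away from 0 this is \<open>|w|^2 / |w|^3\<close>; at 0 both sides vanish by the
  convention \<open>1 / 0 = 0\<close>. It expresses that \<open>1 / norm w\<close> is homogeneous of
  degree -1.\<close>

lemma inner_coulomb_field_self: "w \<bullet> coulomb_field w = 1 / norm w"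
  by (cases "w = 0") (simp_all add: coulomb_field_def dot_square_norm power3_eq_cube power2_eq_square)

lemma continuous_on_coulomb_field [continuous_intros]:
  assumes "continuous_on S f" "\<And>x. x \<in> S \<Longrightarrow> f x \<noteq> 0"
  shows "continuous_on S (\<lambda>x. coulomb_field (f x))"
  unfolding coulomb_field_def using assms by (intro continuous_intros) auto

lemma GDERIV_inverse_norm:
  fixes w :: "'a::real_inner"
  assumes "w \<noteq> 0"
  shows "GDERIV (\<lambda>w. 1 / norm w) w :> - coulomb_field w"
proof -
  have "GDERIV (\<lambda>w. inverse (norm w)) w :> - (inverse (norm w))\<^sup>2 *\<^sub>R sgn w"
    using assms by (intro GDERIV_inverse GDERIV_norm) auto
  moreover have "- (inverse (norm w))\<^sup>2 *\<^sub>R sgn w = - coulomb_field w"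
    by (simp add: coulomb_field_def sgn_div_norm field_simps power2_eq_square power3_eq_cube)
  ultimately show ?thesis by (simp add: inverse_eq_divide)
qed

lemma has_real_derivative_inverse_norm_line:
  fixes b c :: "'a::real_inner"
  assumes "s *\<^sub>R b + c \<noteq> 0"
  shows "((\<lambda>s. 1 / norm (s *\<^sub>R b + c)) has_real_derivative - (b \<bullet> coulomb_field (s *\<^sub>R b + c))) (at s)"
proof -
  have "((\<lambda>w. 1 / norm w) has_derivative (\<lambda>h. h \<bullet> - coulomb_field (s *\<^sub>R b + c))) (at (s *\<^sub>R b + c))"
    using GDERIV_inverse_norm[OF assms] by (simp add: gderiv_def)
  moreover have "((\<lambda>s. s *\<^sub>R b + c) has_derivative (\<lambda>h. h *\<^sub>R b)) (at s)"
    by (auto intro!: derivative_eq_intros)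
  ultimately have "((\<lambda>s. 1 / norm (s *\<^sub>R b + c)) has_derivative (\<lambda>h. h *\<^sub>R b \<bullet> - coulomb_field (s *\<^sub>R b + c))) (at s)"
    by (rule has_derivative_compose[rotated])
  then show ?thesis
    unfolding has_field_derivative_def by (rule has_derivative_eq_rhs) (auto simp: fun_eq_iff)
qed

text \<open>With \<open>f = 1 / |r|\<close> at fixed \<open>c\<close>, these integrate the
  divergences of \<open>(f, 0)\<close>, \<open>(0, f)\<close> and \<open>(s f, t f)\<close> over the
  triangle. The first two leave a leg and the hypotenuse. In the third the legs drop out, because
  the relevant coordinate is zero there.\<close>

lemma
  fixes b1 b2 c :: "'a::euclidean_space"
  assumes nz: "\<And>p. p \<in> simplex2 \<Longrightarrow> fst p *\<^sub>R b1 + snd p *\<^sub>R b2 + c \<noteq> 0"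
  shows simplex2_flux_fst:
      "b1 \<bullet> (LINT p:simplex2|lborel. coulomb_field (fst p *\<^sub>R b1 + snd p *\<^sub>R b2 + c)) =
         (LINT s:{0..1}|lborel. 1 / norm (s *\<^sub>R b2 + c)) -
         (LINT s:{0..1}|lborel. 1 / norm (s *\<^sub>R (b2 - b1) + (b1 + c)))"
    and simplex2_flux_snd:
      "b2 \<bullet> (LINT p:simplex2|lborel. coulomb_field (fst p *\<^sub>R b1 + snd p *\<^sub>R b2 + c)) =
         (LINT s:{0..1}|lborel. 1 / norm (s *\<^sub>R b1 + c)) -
         (LINT s:{0..1}|lborel. 1 / norm (s *\<^sub>R (b2 - b1) + (b1 + c)))"
    and simplex2_flux_radial:
      "(LINT p:simplex2|lborel. 2 * (1 / norm (fst p *\<^sub>R b1 + snd p *\<^sub>R b2 + c)) -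
          (fst p *\<^sub>R b1 + snd p *\<^sub>R b2) \<bullet> coulomb_field (fst p *\<^sub>R b1 + snd p *\<^sub>R b2 + c)) =
         (LINT s:{0..1}|lborel. 1 / norm (s *\<^sub>R (b2 - b1) + (b1 + c)))"
proof -
  define r where "r = (\<lambda>p. fst p *\<^sub>R b1 + snd p *\<^sub>R b2 + c)"
  define f where "f = (\<lambda>p. 1 / norm (r p))"
  define K where "K = (\<lambda>p. coulomb_field (r p))"
  have nz': "r p \<noteq> 0" if "p \<in> simplex2" for p using nz[OF that] by (simp add: r_def)
  have cr: "continuous_on S r" for S by (auto simp: r_def intro!: continuous_intros)
  have cf: "continuous_on simplex2 f"
    unfolding f_def using nz' by (intro continuous_intros cr) auto
  have cK: "continuous_on simplex2 K"
    unfolding K_def using nz' by (intro continuous_intros cr) auto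
  have d1: "((\<lambda>s. f (s, t)) has_real_derivative - (b1 \<bullet> K (s, t))) (at s)" if "(s, t) \<in> simplex2" for s t
    using has_real_derivative_inverse_norm_line[of s b1 "t *\<^sub>R b2 + c"] nz'[OF that]
    by (simp add: f_def K_def r_def add.assoc)
  have d2: "((\<lambda>t. f (s, t)) has_real_derivative - (b2 \<bullet> K (s, t))) (at t)" if "(s, t) \<in> simplex2" for s t
    using has_real_derivative_inverse_norm_line[of t b2 "s *\<^sub>R b1 + c"] nz'[OF that]
    by (simp add: f_def K_def r_def ac_simps)
  \<comment> \<open>The hypotenuse is traversed from the vertex of \<open>b1\<close> to that of
    \<open>b2\<close>, the form that the second and fifth prism integrals use.\<close>
  have hyp: "f (1 - s, s) = 1 / norm (s *\<^sub>R (b2 - b1) + (b1 + c))" for s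
    by (simp add: f_def r_def algebra_simps)
  \<comment> \<open>Integration in the second coordinate yields the hypotenuse as
    \<open>(s, 1 - s)\<close>; reflection restores the orientation of \<open>hyp\<close>.\<close>
  have refl: "(LINT s:{0..1}|lborel. g s * f (s, 1 - s)) = (LINT s:{0..1}|lborel. g (1 - s) * f (1 - s, s))" for g
    using set_integral_reflect_01[of "\<lambda>s. g s * f (s, 1 - s)"] by simp
  have "(LINT p:simplex2|lborel. - (b1 \<bullet> K p)) =
       (LINT t:{0..1}|lborel. f (1 - t, t)) - (LINT t:{0..1}|lborel. f (0, t))"
    by (intro simplex2_integral_deriv_fst cf d1 continuous_intros cK)
  moreover have "(LINT p:simplex2|lborel. - (b \<bullet> K p)) = - (b \<bullet> (LINT p:simplex2|lborel. K p))" for b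
    using set_integral_inner_right(2)[OF set_integrable_compact[OF compact_simplex2 cK], of "- b"] by simp
  ultimately show "b1 \<bullet> (LINT p:simplex2|lborel. coulomb_field (fst p *\<^sub>R b1 + snd p *\<^sub>R b2 + c)) =
         (LINT s:{0..1}|lborel. 1 / norm (s *\<^sub>R b2 + c)) -
         (LINT s:{0..1}|lborel. 1 / norm (s *\<^sub>R (b2 - b1) + (b1 + c)))"
    by (simp add: hyp) (simp add: K_def f_def r_def)
  have "(LINT p:simplex2|lborel. - (b2 \<bullet> K p)) =
       (LINT s:{0..1}|lborel. f (s, 1 - s)) - (LINT s:{0..1}|lborel. f (s, 0))"
    by (intro simplex2_integral_deriv_snd cf d2 continuous_intros cK)
  moreover have "(LINT p:simplex2|lborel. - (b \<bullet> K p)) = - (b \<bullet> (LINT p:simplex2|lborel. K p))" for b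
    using set_integral_inner_right(2)[OF set_integrable_compact[OF compact_simplex2 cK], of "- b"] by simp
  ultimately show "b2 \<bullet> (LINT p:simplex2|lborel. coulomb_field (fst p *\<^sub>R b1 + snd p *\<^sub>R b2 + c)) =
         (LINT s:{0..1}|lborel. 1 / norm (s *\<^sub>R b1 + c)) -
         (LINT s:{0..1}|lborel. 1 / norm (s *\<^sub>R (b2 - b1) + (b1 + c)))"
    using refl[of "\<lambda>_. 1"] by (simp add: hyp) (simp add: K_def f_def r_def)
  have chyp: "continuous_on {0..1} (\<lambda>s. f (1 - s, s))"
    by (intro continuous_on_compose2[OF cf] continuous_intros) (auto simp: simplex2_def)
  \<comment> \<open>The integrand is the derivative of \<open>s * f (s, t)\<close> in
    \<open>s\<close> by the product rule; on the leg \<open>s = 0\<close> the primitive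
    vanishes.\<close>
  have "(LINT p:simplex2|lborel. f p + fst p * - (b1 \<bullet> K p)) =
     (LINT t:{0..1}|lborel. fst (1 - t, t) * f (1 - t, t)) - (LINT t:{0..1}|lborel. fst (0::real, t) * f (0, t))"
    by (rule simplex2_integral_deriv_fst)
       (auto intro!: continuous_intros cf cK derivative_eq_intros d1)
  moreover have "(LINT p:simplex2|lborel. f p + snd p * - (b2 \<bullet> K p)) =
     (LINT s:{0..1}|lborel. snd (s, 1 - s) * f (s, 1 - s)) - (LINT s:{0..1}|lborel. snd (s, 0::real) * f (s, 0))"
    by (rule simplex2_integral_deriv_snd)
       (auto intro!: continuous_intros cf cK derivative_eq_intros d2)
  ultimately have "(LINT p:simplex2|lborel. f p + fst p * - (b1 \<bullet> K p)) + (LINT p:simplex2|lborel. f p + snd p * - (b2 \<bullet> K p)) =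
     (LINT t:{0..1}|lborel. (1 - t) * f (1 - t, t)) + (LINT t:{0..1}|lborel. t * f (1 - t, t))"
    using refl[of "\<lambda>s. 1 - s"] by simp
  \<comment> \<open>The two weights on the hypotenuse add up to 1, which leaves the unweighted line
    integral.\<close>
  also have "\<dots> = (LINT t:{0..1}|lborel. (1 - t) * f (1 - t, t) + t * f (1 - t, t))"
    by (intro set_integral_add(2)[symmetric] set_integrable_compact compact_Icc continuous_intros chyp)
  also have "\<dots> = (LINT t:{0..1}|lborel. f (1 - t, t))"
    by (simp add: algebra_simps)
  also have "(LINT p:simplex2|lborel. f p + fst p * - (b1 \<bullet> K p)) + (LINT p:simplex2|lborel. f p + snd p * - (b2 \<bullet> K p)) =
     (LINT p:simplex2|lborel. (f p + fst p * - (b1 \<bullet> K p)) + (f p + snd p * - (b2 \<bullet> K p)))"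
    by (intro set_integral_add(2)[symmetric] set_integrable_compact compact_simplex2 continuous_intros cf cK)
  also have "\<dots> = (LINT p:simplex2|lborel. 2 * f p - (fst p *\<^sub>R b1 + snd p *\<^sub>R b2) \<bullet> K p)"
    by (simp add: inner_add_left algebra_simps)
  finally show "(LINT p:simplex2|lborel. 2 * (1 / norm (fst p *\<^sub>R b1 + snd p *\<^sub>R b2 + c)) -
          (fst p *\<^sub>R b1 + snd p *\<^sub>R b2) \<bullet> coulomb_field (fst p *\<^sub>R b1 + snd p *\<^sub>R b2 + c)) =
         (LINT s:{0..1}|lborel. 1 / norm (s *\<^sub>R (b2 - b1) + (b1 + c)))"
    by (simp only: hyp) (simp add: K_def f_def r_def)
qed

section \<open>Prism integrals and fluxes over pairs of triangles\<close>

lemma prism_integral_simplex2: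
  assumes nz: "\<And>p s. p \<in> simplex2 \<Longrightarrow> s \<in> {0..1} \<Longrightarrow> s *\<^sub>R b3 + (fst p *\<^sub>R b1 + snd p *\<^sub>R b2 + f) \<noteq> 0"
  shows "set_integrable lborel simplex2
           (\<lambda>p. LINT s:{0..1}|lborel. 1 / norm (s *\<^sub>R b3 + (fst p *\<^sub>R b1 + snd p *\<^sub>R b2 + f)))"
    and "prism_integral b1 b2 b3 f =
           (LINT p:simplex2|lborel. LINT s:{0..1}|lborel. 1 / norm (s *\<^sub>R b3 + (fst p *\<^sub>R b1 + snd p *\<^sub>R b2 + f)))"
proof -
  have "continuous_on (simplex2 \<times> {0..1})
      (\<lambda>z. 1 / norm (snd z *\<^sub>R b3 + (fst (fst z) *\<^sub>R b1 + snd (fst z) *\<^sub>R b2 + f)))"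
    using nz by (intro continuous_intros) auto
  from set_integrable_compact_inner[OF compact_simplex2 compact_Icc this]
  show int: "set_integrable lborel simplex2
           (\<lambda>p. LINT s:{0..1}|lborel. 1 / norm (s *\<^sub>R b3 + (fst p *\<^sub>R b1 + snd p *\<^sub>R b2 + f)))"
    by simp
  show "prism_integral b1 b2 b3 f =
           (LINT p:simplex2|lborel. LINT s:{0..1}|lborel. 1 / norm (s *\<^sub>R b3 + (fst p *\<^sub>R b1 + snd p *\<^sub>R b2 + f)))"
    unfolding simplex2_integral_fst[OF int] prism_integral_def by (simp add: ac_simps)
qed

text \<open>The grouping isolates the part that is constant in \<open>p\<close>, so that it can
  serve as the \<open>c\<close> of the fluxes over one triangle. For a pair of triangles,
  \<open>b3\<close> and \<open>b4\<close> are the negated edge vectors of the second one.\<close>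

definition bary_diff :: "real^3 \<Rightarrow> real^3 \<Rightarrow> real^3 \<Rightarrow> real^3 \<Rightarrow> real^3 \<Rightarrow> real \<times> real \<Rightarrow> real \<times> real \<Rightarrow> real^3" where
  "bary_diff b1 b2 b3 b4 e p q = fst p *\<^sub>R b1 + snd p *\<^sub>R b2 + (fst q *\<^sub>R b3 + snd q *\<^sub>R b4 + e)"

lemma bary_diff_swap: "bary_diff b1 b2 b3 b4 e p q = bary_diff b3 b4 b1 b2 e q p"
  by (simp add: bary_diff_def ac_simps)

lemma continuous_on_bary_diff [continuous_intros]:
  assumes "continuous_on S f" "continuous_on S g"
  shows "continuous_on S (\<lambda>z. bary_diff b1 b2 b3 b4 e (f z) (g z))"
  unfolding bary_diff_def using assms by (intro continuous_intros)

text \<open>For fixed \<open>q\<close> these are the fluxes over one triangle. Integrating over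
  \<open>q\<close> turns each line integral along a leg or the hypotenuse into a prism integral with
  base spanned by \<open>b3\<close>, \<open>b4\<close>.\<close>

lemma
  assumes nz: "\<And>p q. p \<in> simplex2 \<Longrightarrow> q \<in> simplex2 \<Longrightarrow> bary_diff b1 b2 b3 b4 e p q \<noteq> 0"
  shows double_flux_fst:
      "b1 \<bullet> (LINT q:simplex2|lborel. LINT p:simplex2|lborel. coulomb_field (bary_diff b1 b2 b3 b4 e p q)) =
         prism_integral b3 b4 b2 e - prism_integral b3 b4 (b2 - b1) (e + b1)"
    and double_flux_snd:
      "b2 \<bullet> (LINT q:simplex2|lborel. LINT p:simplex2|lborel. coulomb_field (bary_diff b1 b2 b3 b4 e p q)) =
         prism_integral b3 b4 b1 e - prism_integral b3 b4 (b2 - b1) (e + b1)"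
    and double_flux_radial:
      "(LINT q:simplex2|lborel. LINT p:simplex2|lborel. 2 * (1 / norm (bary_diff b1 b2 b3 b4 e p q)) -
          (fst p *\<^sub>R b1 + snd p *\<^sub>R b2) \<bullet> coulomb_field (bary_diff b1 b2 b3 b4 e p q)) =
       prism_integral b3 b4 (b2 - b1) (e + b1)"
proof -
  define c where "c = (\<lambda>q. fst q *\<^sub>R b3 + snd q *\<^sub>R b4 + e)"
  have r: "bary_diff b1 b2 b3 b4 e p q = fst p *\<^sub>R b1 + snd p *\<^sub>R b2 + c q" for p q
    by (simp add: bary_diff_def c_def)
  have nzc: "fst p *\<^sub>R b1 + snd p *\<^sub>R b2 + c q \<noteq> 0" if "p \<in> simplex2" "q \<in> simplex2" for p q
    using nz[OF that] by (simp add: r)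
  \<comment> \<open>The legs and the hypotenuse consist of the parameter points
    \<open>(s, 0)\<close>, \<open>(0, s)\<close> and \<open>(1 - s, s)\<close>, so \<open>nz\<close>
    covers all three prisms.\<close>
  have nz1: "s *\<^sub>R b1 + c q \<noteq> 0" and nz2: "s *\<^sub>R b2 + c q \<noteq> 0"
    and nzh: "s *\<^sub>R (b2 - b1) + (b1 + c q) \<noteq> 0" if "q \<in> simplex2" "s \<in> {0..1}" for q s
    using nzc[of "(s, 0)" q] nzc[of "(0, s)" q] nzc[of "(1 - s, s)" q] that
    by (auto simp: simplex2_def algebra_simps)
  have assoc: "b1 + c q = fst q *\<^sub>R b3 + snd q *\<^sub>R b4 + (e + b1)" for q
    by (simp add: c_def)
  have "set_integrable lborel simplex2 (\<lambda>q. LINT s:{0..1}|lborel. 1 / norm (s *\<^sub>R b1 + c q)) \<and>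
     prism_integral b3 b4 b1 e = (LINT q:simplex2|lborel. LINT s:{0..1}|lborel. 1 / norm (s *\<^sub>R b1 + c q))"
    using prism_integral_simplex2[OF nz1[unfolded c_def]] by (simp add: c_def)
  then have i1: "set_integrable lborel simplex2 (\<lambda>q. LINT s:{0..1}|lborel. 1 / norm (s *\<^sub>R b1 + c q))"
     and J1: "prism_integral b3 b4 b1 e = (LINT q:simplex2|lborel. LINT s:{0..1}|lborel. 1 / norm (s *\<^sub>R b1 + c q))"
    by auto
  have "set_integrable lborel simplex2 (\<lambda>q. LINT s:{0..1}|lborel. 1 / norm (s *\<^sub>R b2 + c q)) \<and>
     prism_integral b3 b4 b2 e = (LINT q:simplex2|lborel. LINT s:{0..1}|lborel. 1 / norm (s *\<^sub>R b2 + c q))"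
    using prism_integral_simplex2[OF nz2[unfolded c_def]] by (simp add: c_def)
  then have i2: "set_integrable lborel simplex2 (\<lambda>q. LINT s:{0..1}|lborel. 1 / norm (s *\<^sub>R b2 + c q))"
     and J2: "prism_integral b3 b4 b2 e = (LINT q:simplex2|lborel. LINT s:{0..1}|lborel. 1 / norm (s *\<^sub>R b2 + c q))"
    by auto
  have "set_integrable lborel simplex2 (\<lambda>q. LINT s:{0..1}|lborel. 1 / norm (s *\<^sub>R (b2 - b1) + (b1 + c q))) \<and>
     prism_integral b3 b4 (b2 - b1) (e + b1) =
       (LINT q:simplex2|lborel. LINT s:{0..1}|lborel. 1 / norm (s *\<^sub>R (b2 - b1) + (b1 + c q)))"
    using prism_integral_simplex2[OF nzh[unfolded assoc]] by (simp add: assoc)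
  then have ih: "set_integrable lborel simplex2 (\<lambda>q. LINT s:{0..1}|lborel. 1 / norm (s *\<^sub>R (b2 - b1) + (b1 + c q)))"
     and Jh: "prism_integral b3 b4 (b2 - b1) (e + b1) =
       (LINT q:simplex2|lborel. LINT s:{0..1}|lborel. 1 / norm (s *\<^sub>R (b2 - b1) + (b1 + c q)))"
    by auto
  have "continuous_on (simplex2 \<times> simplex2) (\<lambda>z. coulomb_field (bary_diff b1 b2 b3 b4 e (snd z) (fst z)))"
    by (intro continuous_intros) (auto simp: nz)
  from set_integrable_compact_inner[OF compact_simplex2 compact_simplex2 this]
  have iK: "set_integrable lborel simplex2 (\<lambda>q. LINT p:simplex2|lborel. coulomb_field (bary_diff b1 b2 b3 b4 e p q))"
    by simp
  have "b1 \<bullet> (LINT q:simplex2|lborel. LINT p:simplex2|lborel. coulomb_field (bary_diff b1 b2 b3 b4 e p q)) =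
     (LINT q:simplex2|lborel. b1 \<bullet> (LINT p:simplex2|lborel. coulomb_field (bary_diff b1 b2 b3 b4 e p q)))"
    by (rule set_integral_inner_right(2)[OF iK, symmetric])
  also have "\<dots> = (LINT q:simplex2|lborel. (LINT s:{0..1}|lborel. 1 / norm (s *\<^sub>R b2 + c q)) -
         (LINT s:{0..1}|lborel. 1 / norm (s *\<^sub>R (b2 - b1) + (b1 + c q))))"
    unfolding r by (intro set_lebesgue_integral_cong allI impI simplex2_flux_fst nzc) auto
  also have "\<dots> = prism_integral b3 b4 b2 e - prism_integral b3 b4 (b2 - b1) (e + b1)"
    unfolding J2 Jh by (rule set_integral_diff[OF i2 ih])
  finally show "b1 \<bullet> (LINT q:simplex2|lborel. LINT p:simplex2|lborel. coulomb_field (bary_diff b1 b2 b3 b4 e p q)) =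
         prism_integral b3 b4 b2 e - prism_integral b3 b4 (b2 - b1) (e + b1)" .
  have "b2 \<bullet> (LINT q:simplex2|lborel. LINT p:simplex2|lborel. coulomb_field (bary_diff b1 b2 b3 b4 e p q)) =
     (LINT q:simplex2|lborel. b2 \<bullet> (LINT p:simplex2|lborel. coulomb_field (bary_diff b1 b2 b3 b4 e p q)))"
    by (rule set_integral_inner_right(2)[OF iK, symmetric])
  also have "\<dots> = (LINT q:simplex2|lborel. (LINT s:{0..1}|lborel. 1 / norm (s *\<^sub>R b1 + c q)) -
         (LINT s:{0..1}|lborel. 1 / norm (s *\<^sub>R (b2 - b1) + (b1 + c q))))"
    unfolding r by (intro set_lebesgue_integral_cong allI impI simplex2_flux_snd nzc) auto
  also have "\<dots> = prism_integral b3 b4 b1 e - prism_integral b3 b4 (b2 - b1) (e + b1)"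
    unfolding J1 Jh by (rule set_integral_diff[OF i1 ih])
  finally show "b2 \<bullet> (LINT q:simplex2|lborel. LINT p:simplex2|lborel. coulomb_field (bary_diff b1 b2 b3 b4 e p q)) =
         prism_integral b3 b4 b1 e - prism_integral b3 b4 (b2 - b1) (e + b1)" .
  show "(LINT q:simplex2|lborel. LINT p:simplex2|lborel. 2 * (1 / norm (bary_diff b1 b2 b3 b4 e p q)) -
          (fst p *\<^sub>R b1 + snd p *\<^sub>R b2) \<bullet> coulomb_field (bary_diff b1 b2 b3 b4 e p q)) =
       prism_integral b3 b4 (b2 - b1) (e + b1)"
    unfolding r Jh by (intro set_lebesgue_integral_cong allI impI simplex2_flux_radial nzc) auto
qed

text \<open>Exchanging the order of integration makes the fluxes along \<open>b3\<close>,
  \<open>b4\<close> available for the same \<open>W\<close>. The second claim adds the radial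
  identities of both triangles, that is, it integrates the divergence of the four coordinates times
  \<open>1 / |r|\<close>.\<close>

lemma
  fixes b1 b2 b3 b4 e :: "real^3"
  assumes nz: "\<And>p q. p \<in> simplex2 \<Longrightarrow> q \<in> simplex2 \<Longrightarrow> bary_diff b1 b2 b3 b4 e p q \<noteq> 0"
  defines "W \<equiv> LINT q:simplex2|lborel. LINT p:simplex2|lborel. coulomb_field (bary_diff b1 b2 b3 b4 e p q)"
    and "I \<equiv> LINT q:simplex2|lborel. LINT p:simplex2|lborel. 1 / norm (bary_diff b1 b2 b3 b4 e p q)"
  shows double_flux_swap:
      "W = (LINT p:simplex2|lborel. LINT q:simplex2|lborel. coulomb_field (bary_diff b3 b4 b1 b2 e q p))"
    and double_flux_total:
      "3 * I + e \<bullet> W =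
         prism_integral b3 b4 (b2 - b1) (e + b1) + prism_integral b1 b2 (b4 - b3) (e + b3)"
proof -
  let ?r = "bary_diff b1 b2 b3 b4 e"
  let ?T = "simplex2 \<times> simplex2 :: ((real \<times> real) \<times> real \<times> real) set"
  have cK: "continuous_on ?T (\<lambda>z. coulomb_field (?r (snd z) (fst z)))"
    by (intro continuous_intros) (auto simp: nz)
  have cf: "continuous_on ?T (\<lambda>z. 1 / norm (?r (snd z) (fst z)))"
    by (intro continuous_intros) (auto simp: nz)
  have swap: "(LINT q:simplex2|lborel. LINT p:simplex2|lborel. f q p) = (LINT p:simplex2|lborel. LINT q:simplex2|lborel. f q p)"
    if "continuous_on ?T (\<lambda>z. f (fst z) (snd z))" for f :: "_ \<Rightarrow> _ \<Rightarrow> 'b::{banach, second_countable_topology}"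
    using set_integral_compact_swap[OF compact_simplex2 compact_simplex2 that] by simp
  have add: "(LINT q:simplex2|lborel. LINT p:simplex2|lborel. f q p + g q p) =
      (LINT q:simplex2|lborel. LINT p:simplex2|lborel. f q p) + (LINT q:simplex2|lborel. LINT p:simplex2|lborel. g q p)"
    if f: "continuous_on ?T (\<lambda>z. f (fst z) (snd z))" and g: "continuous_on ?T (\<lambda>z. g (fst z) (snd z))"
    for f g :: "_ \<Rightarrow> _ \<Rightarrow> real"
  proof -
    have slice: "set_integrable lborel simplex2 (h q)"
      if "continuous_on ?T (\<lambda>z. h (fst z) (snd z))" "q \<in> simplex2" for h :: "_ \<Rightarrow> _ \<Rightarrow> real" and q
    proof (rule set_integrable_compact[OF compact_simplex2])
      have "continuous_on simplex2 (\<lambda>p. h (fst (q, p)) (snd (q, p)))"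
        by (rule continuous_on_compose2[OF that(1)]) (use that(2) in \<open>auto intro!: continuous_intros\<close>)
      then show "continuous_on simplex2 (h q)" by simp
    qed
    have "(LINT q:simplex2|lborel. LINT p:simplex2|lborel. f q p + g q p) =
        (LINT q:simplex2|lborel. (LINT p:simplex2|lborel. f q p) + (LINT p:simplex2|lborel. g q p))"
      by (intro set_lebesgue_integral_cong allI impI set_integral_add slice f g) auto
    also have "\<dots> = (LINT q:simplex2|lborel. LINT p:simplex2|lborel. f q p) + (LINT q:simplex2|lborel. LINT p:simplex2|lborel. g q p)"
      using set_integrable_compact_inner[OF compact_simplex2 compact_simplex2 f]
        set_integrable_compact_inner[OF compact_simplex2 compact_simplex2 g]
      by (intro set_integral_add) auto
    finally show ?thesis .
  qed
  show sw: "W = (LINT p:simplex2|lborel. LINT q:simplex2|lborel. coulomb_field (bary_diff b3 b4 b1 b2 e q p))"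
    unfolding W_def bary_diff_swap[of b3] by (rule swap) (rule cK)
  let ?A = "\<lambda>q p. 2 * (1 / norm (?r p q)) - (fst p *\<^sub>R b1 + snd p *\<^sub>R b2) \<bullet> coulomb_field (?r p q)"
  let ?B = "\<lambda>q p. 2 * (1 / norm (?r p q)) - (fst q *\<^sub>R b3 + snd q *\<^sub>R b4) \<bullet> coulomb_field (?r p q)"
  have cA: "continuous_on ?T (\<lambda>z. ?A (fst z) (snd z))" and cB: "continuous_on ?T (\<lambda>z. ?B (fst z) (snd z))"
    by (intro continuous_intros; auto simp: nz)+
  have A: "(LINT q:simplex2|lborel. LINT p:simplex2|lborel. ?A q p) = prism_integral b3 b4 (b2 - b1) (e + b1)"
    by (rule double_flux_radial[OF nz])
  have "(LINT p:simplex2|lborel. LINT q:simplex2|lborel. ?B q p) = prism_integral b1 b2 (b4 - b3) (e + b3)"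
    unfolding bary_diff_swap[of b1 b2 b3 b4] by (rule double_flux_radial) (simp add: nz bary_diff_swap[of b3 b4])
  then have B: "(LINT q:simplex2|lborel. LINT p:simplex2|lborel. ?B q p) = prism_integral b1 b2 (b4 - b3) (e + b3)"
    using swap[OF cB] by simp
  \<comment> \<open>The two subtracted vectors sum to \<open>r - e\<close>, and \<open>r\<close>
    paired with the field is \<open>1 / |r|\<close>; of four copies of \<open>1 / |r|\<close> three
    remain.\<close>
  have AB: "?A q p + ?B q p = 3 * (1 / norm (?r p q)) + e \<bullet> coulomb_field (?r p q)" for p q
  proof -
    have "1 / norm (?r p q) = (fst p *\<^sub>R b1 + snd p *\<^sub>R b2 + (fst q *\<^sub>R b3 + snd q *\<^sub>R b4 + e)) \<bullet> coulomb_field (?r p q)"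
      using inner_coulomb_field_self[of "?r p q"] by (simp add: bary_diff_def)
    then show ?thesis by (simp add: inner_add_left algebra_simps)
  qed
  have inner: "(LINT q:simplex2|lborel. LINT p:simplex2|lborel. e \<bullet> coulomb_field (?r p q)) = e \<bullet> W"
  proof -
    have "(LINT p:simplex2|lborel. e \<bullet> coulomb_field (?r p q)) = e \<bullet> (LINT p:simplex2|lborel. coulomb_field (?r p q))"
      if "q \<in> simplex2" for q
      by (intro set_integral_inner_right set_integrable_compact compact_simplex2 continuous_intros) (simp add: nz that)
    then have "(LINT q:simplex2|lborel. LINT p:simplex2|lborel. e \<bullet> coulomb_field (?r p q)) =
       (LINT q:simplex2|lborel. e \<bullet> (LINT p:simplex2|lborel. coulomb_field (?r p q)))"
      by (intro set_lebesgue_integral_cong) auto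
    also have "\<dots> = e \<bullet> W"
      using set_integrable_compact_inner[OF compact_simplex2 compact_simplex2 cK]
      unfolding W_def by (intro set_integral_inner_right) simp
    finally show ?thesis .
  qed
  have "prism_integral b3 b4 (b2 - b1) (e + b1) + prism_integral b1 b2 (b4 - b3) (e + b3) =
      (LINT q:simplex2|lborel. LINT p:simplex2|lborel. ?A q p + ?B q p)"
    unfolding add[OF cA cB] A B by simp
  also have "\<dots> = (LINT q:simplex2|lborel. LINT p:simplex2|lborel. 3 * (1 / norm (?r p q)) + e \<bullet> coulomb_field (?r p q))"
    by (simp only: AB)
  also have "\<dots> = (LINT q:simplex2|lborel. LINT p:simplex2|lborel. 3 * (1 / norm (?r p q))) + e \<bullet> W"
    unfolding inner[symmetric] by (rule add; intro continuous_intros; auto simp: nz)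
  also have "(LINT q:simplex2|lborel. LINT p:simplex2|lborel. 3 * (1 / norm (?r p q))) = 3 * I"
    unfolding I_def by (simp only: set_integral_mult_right)
  finally show "3 * I + e \<bullet> W =
         prism_integral b3 b4 (b2 - b1) (e + b1) + prism_integral b1 b2 (b4 - b3) (e + b3)" by simp
qed

section \<open>Gradients of potentials\<close>

lemma gradient_eqI:
  assumes "GDERIV f p :> D"
  shows "gradient f p = D"
  unfolding gradient_def
proof (rule the_equality, rule assms)
  fix E assume "GDERIV f p :> E"
  then have "(\<lambda>h. h \<bullet> E) = (\<lambda>h. h \<bullet> D)"
    using assms has_derivative_unique unfolding gderiv_def by blast
  \<comment> \<open>Both derivatives are evaluated at the increment \<open>E - D\<close>, whence
    \<open>|E - D|^2 = 0\<close>.\<close>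
  then have "(E - D) \<bullet> E = (E - D) \<bullet> D" by (rule fun_cong)
  then show "E = D" by (metis inner_diff_right inner_eq_zero_iff right_minus_eq)
qed

lemma gradient_green:
  assumes "p \<noteq> q"
  shows "gradient (\<lambda>p. green p q) p = - coulomb_field (p - q)"
proof (rule gradient_eqI)
  have "((\<lambda>w. 1 / norm w) has_derivative (\<lambda>h. h \<bullet> - coulomb_field (p - q))) (at (p - q))"
    using GDERIV_inverse_norm[of "p - q"] assms by (simp add: gderiv_def)
  moreover have "((\<lambda>p. p - q) has_derivative (\<lambda>h. h)) (at p)"
    by (auto intro!: derivative_eq_intros)
  ultimately show "GDERIV (\<lambda>p. green p q) p :> - coulomb_field (p - q)"
    unfolding gderiv_def green_def by (rule has_derivative_compose[rotated])
qed

section \<open>Differentiation under the integral sign\<close>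

text \<open>A remainder bound depending on \<open>w\<close> only through \<open>d\<close>, hence
  uniform over an integration domain. Since \<open>a^2 * b\<close> is at least
  \<open>d^3 / 2\<close> and \<open>a^3\<close> at least \<open>d^3\<close>, the two parts of the
  remainder contribute \<open>2 / d^3\<close> and \<open>1 / (2 * d^3)\<close>.\<close>

lemma inverse_norm_taylor:
  fixes w h :: "'a::real_inner"
  assumes d: "0 < d" "d \<le> norm w" "d / 2 \<le> norm (w - h)"
  shows "\<bar>1 / norm (w - h) - 1 / norm w - h \<bullet> coulomb_field w\<bar> \<le> 5 / (2 * d ^ 3) * (norm h)\<^sup>2"
proof -
  define a b k where "a = norm w" and "b = norm (w - h)" and "k = norm h"
  have ab: "0 < a" "d \<le> a" "d / 2 \<le> b" "0 < b" using d by (auto simp: a_def b_def)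
  have b2: "b\<^sup>2 = a\<^sup>2 - 2 * (w \<bullet> h) + k\<^sup>2"
    unfolding a_def b_def k_def power2_norm_eq_inner by (simp add: inner_diff_left inner_diff_right inner_commute)
  have "\<bar>b - a\<bar> \<le> k"
    using norm_triangle_ineq3[of "w - h" w] by (simp add: a_def b_def k_def)
  then have bak: "(b - a)\<^sup>2 \<le> k\<^sup>2"
    using power_mono[of "\<bar>b - a\<bar>" k 2] by simp
  \<comment> \<open>The remainder is a difference of two nonnegative terms, the second because \<open>|b - a| \<le> k\<close>.\<close>
  have aux: "\<bar>X\<bar> \<le> R" if "X = P - Q" "0 \<le> P" "0 \<le> Q" "P \<le> P'" "Q \<le> Q'" "P' + Q' = R"
    for X P Q P' Q' R :: real
    using that by linarith
  have den: "d\<^sup>2 * (d / 2) \<le> a\<^sup>2 * b" "d ^ 3 \<le> a ^ 3"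
    using ab d(1) by (intro mult_mono power_mono; simp)+
  have wh: "w \<bullet> h = (a\<^sup>2 + k\<^sup>2 - b\<^sup>2) / 2" using b2 by simp
  have "1 / b - 1 / a - (w \<bullet> h) / a ^ 3 = (b - a)\<^sup>2 / (a\<^sup>2 * b) - (k\<^sup>2 - (b - a)\<^sup>2) / (2 * a ^ 3)"
    unfolding wh using ab by (simp add: field_simps power2_eq_square power3_eq_cube)
  moreover have "0 \<le> (b - a)\<^sup>2 / (a\<^sup>2 * b)" "0 \<le> (k\<^sup>2 - (b - a)\<^sup>2) / (2 * a ^ 3)"
    using ab bak by auto
  moreover have "(b - a)\<^sup>2 / (a\<^sup>2 * b) \<le> k\<^sup>2 / (d\<^sup>2 * (d / 2))"
    using ab bak d den(1) by (intro frac_le) auto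
  moreover have "(k\<^sup>2 - (b - a)\<^sup>2) / (2 * a ^ 3) \<le> k\<^sup>2 / (2 * d ^ 3)"
    using ab bak d den(2) by (intro frac_le) auto
  moreover have "k\<^sup>2 / (d\<^sup>2 * (d / 2)) + k\<^sup>2 / (2 * d ^ 3) = 5 / (2 * d ^ 3) * k\<^sup>2"
    using d by (simp add: field_simps power2_eq_square power3_eq_cube)
  ultimately have "\<bar>1 / b - 1 / a - (w \<bullet> h) / a ^ 3\<bar> \<le> 5 / (2 * d ^ 3) * k\<^sup>2"
    by (rule aux)
  then show ?thesis
    by (simp add: a_def b_def k_def coulomb_field_def inner_commute)
qed

lemma has_derivative_quadraticI:
  fixes f :: "'a::real_normed_vector \<Rightarrow> 'b::real_normed_vector"
  assumes "bounded_linear f'" "0 < r"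
    and bound: "\<And>h. norm h < r \<Longrightarrow> norm (f (x + h) - f x - f' h) \<le> C * (norm h)\<^sup>2"
  shows "(f has_derivative f') (at x)"
  unfolding has_derivative_at_alt
proof (intro conjI allI impI)
  fix e :: real assume e: "0 < e"
  \<comment> \<open>The choice makes \<open>C * norm h\<close> at most \<open>e\<close>;
    \<open>\<bar>C\<bar> + 1\<close> is a positive bound for \<open>C\<close> whatever its
    sign.\<close>
  define d where "d = min r (e / (\<bar>C\<bar> + 1))"
  have "0 < d" using e assms(2) by (simp add: d_def)
  moreover have "norm (f y - f x - f' (y - x)) \<le> e * norm (y - x)" if "norm (y - x) < d" for y
  proof -
    have "norm (y - x) * (\<bar>C\<bar> + 1) \<le> e"
      using that by (simp add: d_def pos_less_divide_eq)
    moreover have "C * norm (y - x) \<le> norm (y - x) * (\<bar>C\<bar> + 1)"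
      by (subst mult.commute) (intro mult_left_mono, auto)
    ultimately have "C * norm (y - x) * norm (y - x) \<le> e * norm (y - x)"
      by (intro mult_right_mono) auto
    then show ?thesis
      using bound[of "y - x"] that by (simp add: d_def power2_eq_square mult.assoc)
  qed
  ultimately show "\<exists>d>0. \<forall>y. norm (y - x) < d \<longrightarrow> norm (f y - f x - f' (y - x)) \<le> e * norm (y - x)"
    by blast
qed (fact assms(1))

text \<open>The point \<open>q\<close> has positive distance from the compact image, so the Taylor
  bound holds with one constant for all \<open>u\<close> and integrates to a quadratic remainder.
  The sign is positive because \<open>q\<close> enters with a minus.\<close>

lemma GDERIV_potential:
  fixes \<phi> :: "'b::euclidean_space \<Rightarrow> 'a::euclidean_space"
  assumes S: "compact S" and \<phi>: "continuous_on S \<phi>" and q: "q \<notin> \<phi> ` S"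
  shows "GDERIV (\<lambda>q. LINT u:S|lborel. 1 / norm (\<phi> u - q)) q :> (LINT u:S|lborel. coulomb_field (\<phi> u - q))"
proof -
  obtain d where d: "0 < d" "\<And>u. u \<in> S \<Longrightarrow> d \<le> norm (\<phi> u - q)"
    using separate_point_closed[of "\<phi> ` S" q] q compact_imp_closed[OF compact_continuous_image[OF \<phi> S]]
    by (auto simp: dist_norm norm_minus_commute)
  \<comment> \<open>Increments shorter than \<open>d / 2\<close> keep half of the distance, as the
    Taylor bound requires.\<close>
  have far: "d / 2 \<le> norm (\<phi> u - q - h)" if "u \<in> S" "norm h < d / 2" for u h
    using d(2)[OF that(1)] that(2) norm_triangle_ineq2[of "\<phi> u - q" h] by linarith
  have iG: "set_integrable lborel S (\<lambda>u. 1 / norm (\<phi> u - q - h))" if "norm h < d / 2" for h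
  proof -
    have "\<phi> u - q - h \<noteq> 0" if "u \<in> S" for u
      using far[OF that \<open>norm h < d / 2\<close>] d(1) by auto
    then show ?thesis
      by (intro set_integrable_compact S continuous_intros \<phi>) auto
  qed
  have cK: "continuous_on S (\<lambda>u. coulomb_field (\<phi> u - q))"
    using q by (intro continuous_intros \<phi>) auto
  have iK: "set_integrable lborel S (\<lambda>u. coulomb_field (\<phi> u - q))"
    by (rule set_integrable_compact[OF S cK])
  define C where "C = 5 / (2 * d ^ 3)"
  have "((\<lambda>q. LINT u:S|lborel. 1 / norm (\<phi> u - q)) has_derivative
      (\<lambda>h. h \<bullet> (LINT u:S|lborel. coulomb_field (\<phi> u - q)))) (at q)"
  proof (rule has_derivative_quadraticI)
    show "bounded_linear (\<lambda>h. h \<bullet> (LINT u:S|lborel. coulomb_field (\<phi> u - q)))"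
      by (rule bounded_linear_inner_left)
    show "0 < d / 2" using d by simp
    fix h :: 'a assume h: "norm h < d / 2"
    have iG': "set_integrable lborel S (\<lambda>u. 1 / norm (\<phi> u - q))" using iG[of 0] d by simp
    let ?R = "\<lambda>u. 1 / norm (\<phi> u - q - h) - 1 / norm (\<phi> u - q) - h \<bullet> coulomb_field (\<phi> u - q)"
    have iR: "set_integrable lborel S ?R"
      by (intro set_integral_diff set_integral_inner_right iG[OF h] iG' iK)
    have "(LINT u:S|lborel. 1 / norm (\<phi> u - (q + h))) - (LINT u:S|lborel. 1 / norm (\<phi> u - q)) -
        h \<bullet> (LINT u:S|lborel. coulomb_field (\<phi> u - q)) = (LINT u:S|lborel. ?R u)"
      by (simp add: set_integral_diff set_integral_inner_right iG[OF h] iG' iK diff_diff_eq[symmetric])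
    also have "norm \<dots> \<le> (LINT u:S|lborel. norm (?R u))"
      by (rule set_integral_norm_bound[OF iR])
    also have "\<dots> \<le> (LINT u:S|lborel. C * (norm h)\<^sup>2)"
    proof (rule set_integral_mono)
      show "set_integrable lborel S (\<lambda>u. norm (?R u))" by (rule set_integrable_norm[OF iR])
      show "set_integrable lborel S (\<lambda>u. C * (norm h)\<^sup>2)"
        by (intro set_integrable_compact S continuous_intros)
      fix u assume "u \<in> S"
      then show "norm (?R u) \<le> C * (norm h)\<^sup>2"
        unfolding C_def using inverse_norm_taylor[OF d(1) d(2) far[OF _ h]] by simp
    qed
    also have "\<dots> = (C * (LINT u:S|lborel. 1)) * (norm h)\<^sup>2"
      using set_integral_mult_right[of lborel S "C * (norm h)\<^sup>2" "\<lambda>_. 1"] by (simp add: mult_ac)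
    finally show "norm ((LINT u:S|lborel. 1 / norm (\<phi> u - (q + h))) - (LINT u:S|lborel. 1 / norm (\<phi> u - q)) -
        h \<bullet> (LINT u:S|lborel. coulomb_field (\<phi> u - q))) \<le> (C * (LINT u:S|lborel. 1)) * (norm h)\<^sup>2" .
  qed
  then show ?thesis by (simp add: gderiv_def)
qed

section \<open>Surface integrals over flat triangles\<close>

text \<open>The parametrisation is affine, so the area element is the constant norm of the cross
  product of two edges.\<close>

lemma tri_integral_simplex2:
  "tri_integral v f = norm (cross3 (v 2 - v 1) (v 3 - v 1)) *\<^sub>R (LINT u:simplex2|lborel. f (tri_param v u))"
proof -
  have "(tri_param v has_derivative (\<lambda>h. fst h *\<^sub>R (v 2 - v 1) + snd h *\<^sub>R (v 3 - v 1))) (at u)" for u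
    unfolding tri_param_def case_prod_unfold by (auto intro!: derivative_eq_intros)
  then have "frechet_derivative (tri_param v) (at u) = (\<lambda>h. fst h *\<^sub>R (v 2 - v 1) + snd h *\<^sub>R (v 3 - v 1))" for u
    by (rule frechet_derivative_at[symmetric])
  then show ?thesis
    by (simp add: tri_integral_def surface_integral_def)
qed

lemma tri_area_eq: "tri_area v = norm (cross3 (v 2 - v 1) (v 3 - v 1)) / 2"
  by (simp add: tri_area_def tri_integral_simplex2 simplex2_measure)

text \<open>The third edge runs from \<open>v 3\<close> back to \<open>v 1\<close>; its sign cancels
  the minus in the definition.\<close>

lemma tri_normal_eq:
  "tri_normal v = (1 / norm (cross3 (v 2 - v 1) (v 3 - v 1))) *\<^sub>R cross3 (v 2 - v 1) (v 3 - v 1)"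
proof -
  have "tri_edge v 1 = v 2 - v 1" "tri_edge v 3 = - (v 3 - v 1)"
    by (simp_all add: tri_edge_def numeral_2_eq_2)
  then show ?thesis by (simp add: tri_normal_def tri_area_eq del: minus_diff_eq)
qed

lemma continuous_on_tri_param: "continuous_on S (tri_param v)"
  unfolding tri_param_def case_prod_unfold by (intro continuous_intros)

section \<open>Geometry of the triangles\<close>

text \<open>By the Lagrange identity \<open>d\<close> is parallel to the nonzero vector
  \<open>cross3 a b\<close>, to which it is also orthogonal.\<close>

lemma orthogonal_cross3_frame_eq_0:
  fixes a b d :: "real^3"
  assumes "cross3 a b \<noteq> 0" "a \<bullet> d = 0" "b \<bullet> d = 0" "cross3 a b \<bullet> d = 0"
  shows "d = 0"
proof -
  have "cross3 d (cross3 a b) = 0" "d \<bullet> cross3 a b = 0"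
    using assms by (simp_all add: Lagrange inner_commute)
  then show ?thesis using assms(1) norm_and_cross_eq_0 by blast
qed

text \<open>Recovers the tangential part of \<open>w\<close> from its products with two edges. Up to
  the factor \<open>norm (cross3 a b)\<close> and signs, the rotated edges \<open>cross3 b n\<close>
  and \<open>cross3 a n\<close> are the basis of the plane dual to \<open>a\<close>,
  \<open>b\<close>; the equation is tested against \<open>a\<close>, \<open>b\<close> and the
  normal.\<close>

lemma edge_flux_eq_tangential:
  fixes a b w :: "real^3"
  assumes ab: "cross3 a b \<noteq> 0"
    and n: "n = (1 / norm (cross3 a b)) *\<^sub>R cross3 a b"
    and a: "a \<bullet> w = j3 - j2" and b: "b \<bullet> w = j1 - j2"
  shows "j1 *\<^sub>R cross3 a n + j2 *\<^sub>R cross3 (b - a) n - j3 *\<^sub>R cross3 b n =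
           - (norm (cross3 a b) *\<^sub>R (w - (n \<bullet> w) *\<^sub>R n))" (is "?l = ?r")
proof -
  define A where "A = norm (cross3 a b)"
  have A: "A \<noteq> 0" and N: "cross3 a b = A *\<^sub>R n"
    using ab by (simp_all add: A_def n)
  have nn: "n \<bullet> n = 1"
    using ab by (simp add: n dot_square_norm power2_eq_square)
  have na: "a \<bullet> n = 0" "b \<bullet> n = 0"
    by (simp_all add: n dot_cross_self)
  have "cross3 a b \<bullet> n = A"
    by (simp add: N nn)
  then have prods: "a \<bullet> cross3 b n = A" "b \<bullet> cross3 a n = - A"
    by (metis cross_triple inner_commute, metis cross_triple inner_commute cross_skew inner_minus_right)
  have "?l - ?r = 0"
  proof (rule orthogonal_cross3_frame_eq_0[OF ab])
    show "a \<bullet> (?l - ?r) = 0"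
      by (simp add: inner_diff_right inner_add_right Cross3.left_diff_distrib dot_cross_self na a prods A_def[symmetric])
         (simp add: algebra_simps)
    show "b \<bullet> (?l - ?r) = 0"
      by (simp add: inner_diff_right inner_add_right Cross3.left_diff_distrib dot_cross_self na b prods A_def[symmetric])
         (simp add: algebra_simps)
    show "cross3 a b \<bullet> (?l - ?r) = 0"
      by (simp add: N inner_diff_right inner_add_right dot_cross_self nn)
  qed
  then show ?thesis by (simp only: right_minus_eq)
qed

text \<open>Cramer's rule, with the determinants written as triple products.\<close>

lemma cross3_cramer:
  fixes a b c e :: "real^3"
  assumes "cross3 a b \<bullet> c \<noteq> 0"
  shows "\<exists>s t u. e = s *\<^sub>R a + t *\<^sub>R b + u *\<^sub>R c"
proof -
  define d where "d = cross3 a b \<bullet> c"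
  have "d *\<^sub>R e = (cross3 b c \<bullet> e) *\<^sub>R a + (cross3 c a \<bullet> e) *\<^sub>R b + (cross3 a b \<bullet> e) *\<^sub>R c"
    by (simp add: d_def vec_eq_iff forall_3 cross_components inner_vec_def sum_3) (simp add: algebra_simps)
  then have "(1 / d) *\<^sub>R d *\<^sub>R e = (1 / d) *\<^sub>R ((cross3 b c \<bullet> e) *\<^sub>R a + (cross3 c a \<bullet> e) *\<^sub>R b + (cross3 a b \<bullet> e) *\<^sub>R c)"
    by simp
  then have "e = (cross3 b c \<bullet> e / d) *\<^sub>R a + (cross3 c a \<bullet> e / d) *\<^sub>R b + (cross3 a b \<bullet> e / d) *\<^sub>R c"
    using assms by (simp add: d_def scaleR_add_right)
  then show ?thesis by blast
qed

lemma cross3_edges_neq_0: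
  fixes v :: "nat \<Rightarrow> real^3"
  assumes "\<not> collinear {v 1, v 2, v 3}"
  shows "cross3 (v 2 - v 1) (v 3 - v 1) \<noteq> 0"
proof
  assume "cross3 (v 2 - v 1) (v 3 - v 1) = 0"
  then have "collinear {0, v 2 - v 1, v 3 - v 1}" by (simp add: cross_eq_0)
  then have "collinear {v 2, v 1, v 3}" by (subst collinear_3) simp
  then show False using assms by (simp add: insert_commute)
qed

text \<open>The edge length cancels the normalisation of the edge normal; for an edge of length zero
  both sides vanish.\<close>

lemma edge_normal_flux:
  "(2 * norm (tri_edge v i) * c * J) *\<^sub>R edge_normal v i = (2 * c * J) *\<^sub>R cross3 (tri_edge v i) (tri_normal v)"
  by (cases "tri_edge v i = 0") (simp_all add: edge_normal_def)

lemma tri_edges: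
  "tri_edge v 1 = v 2 - v 1" "tri_edge v 2 = (v 3 - v 1) - (v 2 - v 1)" "tri_edge v 3 = - (v 3 - v 1)"
proof -
  have "1 mod 3 + 1 = (2::nat)" "2 mod 3 + 1 = (3::nat)" "3 mod 3 + 1 = (1::nat)" by simp_all
  then show "tri_edge v 1 = v 2 - v 1" "tri_edge v 2 = (v 3 - v 1) - (v 2 - v 1)" "tri_edge v 3 = - (v 3 - v 1)"
    unfolding tri_edge_def by (simp_all only: minus_diff_eq diff_diff_eq2 diff_add_cancel)
qed

section \<open>Layer integrals of two disjoint triangles in barycentric coordinates\<close>

context
  fixes x y :: "nat \<Rightarrow> real^3"
  assumes disj: "flat_triangle x \<inter> flat_triangle y = {}"
begin

private abbreviation r :: "real \<times> real \<Rightarrow> real \<times> real \<Rightarrow> real^3" where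
  "r \<equiv> bary_diff (x 2 - x 1) (x 3 - x 1) (- (y 2 - y 1)) (- (y 3 - y 1)) (x 1 - y 1)"

lemma tri_param_diff: "tri_param x p - tri_param y q = r p q"
  unfolding tri_param_def bary_diff_def case_prod_unfold by (simp add: algebra_simps)

lemma tri_param_neq: "p \<in> simplex2 \<Longrightarrow> q \<in> simplex2 \<Longrightarrow> tri_param x p \<noteq> tri_param y q"
  using disj tri_param_image[of x] tri_param_image[of y] by blast

lemma bary_diff_neq_0: "p \<in> simplex2 \<Longrightarrow> q \<in> simplex2 \<Longrightarrow> r p q \<noteq> 0"
  by (metis tri_param_neq tri_param_diff right_minus_eq)

lemma single_layer_eq:
  "single_layer x y = norm (cross3 (x 2 - x 1) (x 3 - x 1)) * norm (cross3 (y 2 - y 1) (y 3 - y 1)) *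
     (LINT q:simplex2|lborel. LINT p:simplex2|lborel. 1 / norm (r p q))"
  unfolding single_layer_def tri_integral_simplex2 green_def tri_param_diff by simp

text \<open>The gradient in the first point of the kernel is minus the field, and the constant
  normal moves out of both integrals.\<close>

lemma double_layer_eq:
  "double_layer x y = - (norm (cross3 (x 2 - x 1) (x 3 - x 1)) * norm (cross3 (y 2 - y 1) (y 3 - y 1)) *
     (tri_normal x \<bullet> (LINT q:simplex2|lborel. LINT p:simplex2|lborel. coulomb_field (r p q))))"
proof -
  let ?n = "tri_normal x"
  have c: "continuous_on (simplex2 \<times> simplex2) (\<lambda>z. coulomb_field (r (snd z) (fst z)))"
    by (intro continuous_intros bary_diff_neq_0) auto
  have "(LINT p:simplex2|lborel. ?n \<bullet> gradient (\<lambda>p'. green p' (tri_param y q)) (tri_param x p)) =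
      (- ?n) \<bullet> (LINT p:simplex2|lborel. coulomb_field (r p q))" if q: "q \<in> simplex2" for q
  proof -
    have "(LINT p:simplex2|lborel. ?n \<bullet> gradient (\<lambda>p'. green p' (tri_param y q)) (tri_param x p)) =
       (LINT p:simplex2|lborel. (- ?n) \<bullet> coulomb_field (r p q))"
      by (intro set_lebesgue_integral_cong) (auto simp: gradient_green tri_param_neq q tri_param_diff)
    also have "\<dots> = (- ?n) \<bullet> (LINT p:simplex2|lborel. coulomb_field (r p q))"
      by (intro set_integral_inner_right set_integrable_compact compact_simplex2 continuous_intros
          bary_diff_neq_0 q)
    finally show ?thesis .
  qed
  then have "(LINT q:simplex2|lborel. LINT p:simplex2|lborel. ?n \<bullet> gradient (\<lambda>p'. green p' (tri_param y q)) (tri_param x p)) =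
     (LINT q:simplex2|lborel. (- ?n) \<bullet> (LINT p:simplex2|lborel. coulomb_field (r p q)))"
    by (intro set_lebesgue_integral_cong) auto
  also have "\<dots> = (- ?n) \<bullet> (LINT q:simplex2|lborel. LINT p:simplex2|lborel. coulomb_field (r p q))"
    using set_integrable_compact_inner[OF compact_simplex2 compact_simplex2 c]
    by (intro set_integral_inner_right) simp
  finally show ?thesis
    unfolding double_layer_def tri_integral_simplex2 by simp
qed

text \<open>Disjointness keeps each point of the second triangle off the first, so the potential may
  be differentiated under the integral. Differentiation in the subtracted point gives plus the
  field, opposite to the double layer.\<close>

lemma single_layer_grad_eq:
  "single_layer_grad x y = (norm (cross3 (x 2 - x 1) (x 3 - x 1)) * norm (cross3 (y 2 - y 1) (y 3 - y 1))) *\<^sub>R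
     (LINT q:simplex2|lborel. LINT p:simplex2|lborel. coulomb_field (r p q))"
proof -
  have "gradient (\<lambda>q'. tri_integral x (\<lambda>p. green p q')) (tri_param y q) =
      norm (cross3 (x 2 - x 1) (x 3 - x 1)) *\<^sub>R (LINT p:simplex2|lborel. coulomb_field (r p q))"
    if q: "q \<in> simplex2" for q
  proof (rule gradient_eqI)
    have "GDERIV (\<lambda>q'. LINT p:simplex2|lborel. 1 / norm (tri_param x p - q')) (tri_param y q) :>
        (LINT p:simplex2|lborel. coulomb_field (tri_param x p - tri_param y q))"
      by (rule GDERIV_potential[OF compact_simplex2 continuous_on_tri_param]) (metis imageE tri_param_neq q)
    from GDERIV_mult[OF GDERIV_const this, of "norm (cross3 (x 2 - x 1) (x 3 - x 1))"]
    show "GDERIV (\<lambda>q'. tri_integral x (\<lambda>p. green p q')) (tri_param y q) :>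
        norm (cross3 (x 2 - x 1) (x 3 - x 1)) *\<^sub>R (LINT p:simplex2|lborel. coulomb_field (r p q))"
      by (simp add: tri_integral_simplex2 green_def tri_param_diff)
  qed
  then have "(LINT q:simplex2|lborel. gradient (\<lambda>q'. tri_integral x (\<lambda>p. green p q')) (tri_param y q)) =
    (LINT q:simplex2|lborel. norm (cross3 (x 2 - x 1) (x 3 - x 1)) *\<^sub>R (LINT p:simplex2|lborel. coulomb_field (r p q)))"
    by (intro set_lebesgue_integral_cong) auto
  then show ?thesis
    unfolding single_layer_grad_def tri_integral_simplex2[of y] by (simp add: mult.commute)
qed

end

text \<open>Some edge of \<open>y\<close> leaves the plane of \<open>x\<close> and completes the
  edges of \<open>x\<close> to a basis; the other edge of \<open>y\<close> gets coefficient
  0.\<close>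

lemma tri_normal_spanning:
  fixes x y :: "nat \<Rightarrow> real^3"
  assumes x: "\<not> collinear {x 1, x 2, x 3}" and y: "\<not> collinear {y 1, y 2, y 3}"
    and nonparallel: "\<bar>tri_normal x \<bullet> tri_normal y\<bar> \<noteq> 1"
  shows "\<exists>s t u w. e = s *\<^sub>R (x 2 - x 1) + t *\<^sub>R (x 3 - x 1) + u *\<^sub>R (y 2 - y 1) + w *\<^sub>R (y 3 - y 1)"
proof -
  let ?nx = "cross3 (x 2 - x 1) (x 3 - x 1)" and ?ny = "cross3 (y 2 - y 1) (y 3 - y 1)"
  have n0: "?nx \<noteq> 0" "?ny \<noteq> 0" using cross3_edges_neq_0 x y by auto
  have "?nx \<bullet> (y 2 - y 1) \<noteq> 0 \<or> ?nx \<bullet> (y 3 - y 1) \<noteq> 0"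
  proof (rule ccontr)
    assume "\<not> ?thesis"
    \<comment> \<open>If \<open>?nx\<close> is orthogonal to both edges of \<open>y\<close>, the
      Lagrange identity annihilates the cross product. This forces equality in Cauchy-Schwarz, so
      the unit normals have product 1 or -1.\<close>
    then have "cross3 ?nx ?ny = 0"
      unfolding Lagrange[of ?nx] by simp
    then have "(?nx \<bullet> ?ny)\<^sup>2 = (norm ?nx * norm ?ny)\<^sup>2"
      using norm_cross_dot[of ?nx ?ny] by simp
    then have "\<bar>?nx \<bullet> ?ny\<bar>\<^sup>2 = (norm ?nx * norm ?ny)\<^sup>2" by simp
    then have "\<bar>?nx \<bullet> ?ny\<bar> = norm ?nx * norm ?ny"
      by (rule power2_eq_imp_eq) simp_all
    then have "\<bar>tri_normal x \<bullet> tri_normal y\<bar> = 1"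
      using n0 by (simp add: tri_normal_eq abs_mult)
    then show False using nonparallel by contradiction
  qed
  then show ?thesis
  proof
    assume "?nx \<bullet> (y 2 - y 1) \<noteq> 0"
    from cross3_cramer[OF this, of e] obtain s t u where
      "e = s *\<^sub>R (x 2 - x 1) + t *\<^sub>R (x 3 - x 1) + u *\<^sub>R (y 2 - y 1)" by blast
    then show ?thesis by (intro exI[of _ s] exI[of _ t] exI[of _ u] exI[of _ 0]) simp
  next
    assume "?nx \<bullet> (y 3 - y 1) \<noteq> 0"
    from cross3_cramer[OF this, of e] obtain s t u where
      "e = s *\<^sub>R (x 2 - x 1) + t *\<^sub>R (x 3 - x 1) + u *\<^sub>R (y 3 - y 1)" by blast
    then show ?thesis by (intro exI[of _ s] exI[of _ t] exI[of _ 0] exI[of _ u]) simp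
  qed
qed

section \<open>Determination of the three integrals from the six prism integrals\<close>

theorem mainTheorem2:
  fixes x y :: "nat \<Rightarrow> real^3"
  assumes "\<not> collinear {x 1, x 2, x 3}"
    and "\<not> collinear {y 1, y 2, y 3}"
    and "flat_triangle x \<inter> flat_triangle y = {}"
    and "\<bar>tri_normal x \<bullet> tri_normal y\<bar> \<noteq> 1"
  shows
    "let a1 = x 2 - x 1; a2 = x 3 - x 1; a3 = - (y 2 - y 1); a4 = - (y 3 - y 1);
         e = x 1 - y 1;
         J1 = prism_integral a1 a2 a3 e;
         J2 = prism_integral a1 a2 (a4 - a3) (e + a3);
         J3 = prism_integral a1 a2 a4 e;
         J4 = prism_integral a3 a4 a1 e;
         J5 = prism_integral a3 a4 (a2 - a1) (e + a1);
         J6 = prism_integral a3 a4 a2 e;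
         Ax = tri_area x; Ay = tri_area y;
         nx = tri_normal x; ny = tri_normal y;
         Fy = (2 * norm (tri_edge y 1) * Ax * J1) *\<^sub>R edge_normal y 1
            + (2 * norm (tri_edge y 2) * Ax * J2) *\<^sub>R edge_normal y 2
            + (2 * norm (tri_edge y 3) * Ax * J3) *\<^sub>R edge_normal y 3;
         Fx = (2 * norm (tri_edge x 1) * Ay * J4) *\<^sub>R edge_normal x 1
            + (2 * norm (tri_edge x 2) * Ay * J5) *\<^sub>R edge_normal x 2
            + (2 * norm (tri_edge x 3) * Ay * J6) *\<^sub>R edge_normal x 3;
         L = single_layer x y; M = double_layer x y; L' = single_layer_grad x y
     in M = - ((nx \<bullet> Fy - (nx \<bullet> ny) * (ny \<bullet> Fx)) / (1 - (nx \<bullet> ny)\<^sup>2))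
      \<and> L' = - Fx - M *\<^sub>R nx
      \<and> (\<exists>s10 s20 s30 s40. e = s10 *\<^sub>R a1 + s20 *\<^sub>R a2 + s30 *\<^sub>R a3 + s40 *\<^sub>R a4)
      \<and> (\<forall>s10 s20 s30 s40. e = s10 *\<^sub>R a1 + s20 *\<^sub>R a2 + s30 *\<^sub>R a3 + s40 *\<^sub>R a4 \<longrightarrow>
           L = 4 * Ax * Ay / 3 *
                 (- s40 * J1 + (1 + s30 + s40) * J2 - s30 * J3
                  - s20 * J4 + (1 + s10 + s20) * J5 - s10 * J6))"
proof -
  define a1 a2 a3 a4 e where "a1 = x 2 - x 1" and "a2 = x 3 - x 1"
    and "a3 = - (y 2 - y 1)" and "a4 = - (y 3 - y 1)" and "e = x 1 - y 1"
  define J1 J2 J3 J4 J5 J6 where "J1 = prism_integral a1 a2 a3 e"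
    and "J2 = prism_integral a1 a2 (a4 - a3) (e + a3)"
    and "J3 = prism_integral a1 a2 a4 e"
    and "J4 = prism_integral a3 a4 a1 e"
    and "J5 = prism_integral a3 a4 (a2 - a1) (e + a1)"
    and "J6 = prism_integral a3 a4 a2 e"
  define Ax Ay nx ny where "Ax = tri_area x" and "Ay = tri_area y"
    and "nx = tri_normal x" and "ny = tri_normal y"
  define Fy where "Fy = (2 * norm (tri_edge y 1) * Ax * J1) *\<^sub>R edge_normal y 1
            + (2 * norm (tri_edge y 2) * Ax * J2) *\<^sub>R edge_normal y 2
            + (2 * norm (tri_edge y 3) * Ax * J3) *\<^sub>R edge_normal y 3"
  define Fx where "Fx = (2 * norm (tri_edge x 1) * Ay * J4) *\<^sub>R edge_normal x 1
            + (2 * norm (tri_edge x 2) * Ay * J5) *\<^sub>R edge_normal x 2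
            + (2 * norm (tri_edge x 3) * Ay * J6) *\<^sub>R edge_normal x 3"
  define r where "r = bary_diff a1 a2 a3 a4 e"
  define W where "W = (LINT q:simplex2|lborel. LINT p:simplex2|lborel. coulomb_field (r p q))"
  define I where "I = (LINT q:simplex2|lborel. LINT p:simplex2|lborel. 1 / norm (r p q))"
  note a_def = a1_def a2_def a3_def a4_def e_def
  note J_def = J1_def J2_def J3_def J4_def J5_def J6_def
  \<comment> \<open>The product of the two area elements \<open>2 * Ax\<close> and
    \<open>2 * Ay\<close>.\<close>
  define P where "P = 4 * Ax * Ay"

  have x0: "cross3 a1 a2 \<noteq> 0" and y0: "cross3 (- a3) (- a4) \<noteq> 0"
    unfolding a_def minus_minus using cross3_edges_neq_0 assms(1,2) by blast+
  have Ax: "norm (cross3 a1 a2) = 2 * Ax" and Ay: "norm (cross3 (- a3) (- a4)) = 2 * Ay"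
    unfolding a_def minus_minus Ax_def Ay_def tri_area_eq by simp_all
  have nx: "nx = (1 / norm (cross3 a1 a2)) *\<^sub>R cross3 a1 a2"
    and ny: "ny = (1 / norm (cross3 (- a3) (- a4))) *\<^sub>R cross3 (- a3) (- a4)"
    unfolding a_def minus_minus nx_def ny_def tri_normal_eq by simp_all
  have nxy: "nx \<bullet> nx = 1" "ny \<bullet> ny = 1"
    unfolding nx ny using x0 y0 by (simp_all add: dot_square_norm power2_eq_square)

  have nz: "r p q \<noteq> 0" if "p \<in> simplex2" "q \<in> simplex2" for p q
    unfolding r_def a_def by (rule bary_diff_neq_0[OF assms(3) that])
  then have nz': "bary_diff a3 a4 a1 a2 e p q \<noteq> 0" if "p \<in> simplex2" "q \<in> simplex2" for p q
    using that by (simp add: r_def bary_diff_swap[of a3])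
  \<comment> \<open>With the triangles exchanged, the same two flux identities yield the products of
    \<open>W\<close> with \<open>a3\<close> and \<open>a4\<close>.\<close>
  have W': "W = (LINT p:simplex2|lborel. LINT q:simplex2|lborel. coulomb_field (bary_diff a3 a4 a1 a2 e q p))"
    unfolding W_def r_def by (rule double_flux_swap) (use nz in \<open>simp add: r_def\<close>)
  have W1: "a1 \<bullet> W = J6 - J5" and W2: "a2 \<bullet> W = J4 - J5"
    unfolding W_def r_def J_def using nz by (auto simp: r_def intro!: double_flux_fst double_flux_snd)
  have W3: "a3 \<bullet> W = J3 - J2" and W4: "a4 \<bullet> W = J1 - J2"
    unfolding W' J_def using nz' by (auto intro!: double_flux_fst double_flux_snd)
  have WI: "3 * I + e \<bullet> W = J5 + J2"
    unfolding W_def I_def r_def J_def by (rule double_flux_total) (use nz in \<open>simp add: r_def\<close>)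

  have L: "single_layer x y = P * I"
    using single_layer_eq[OF assms(3)]
    unfolding P_def I_def r_def Ax_def Ay_def tri_area_eq a_def by simp
  have M: "double_layer x y = - (P * (nx \<bullet> W))"
    using double_layer_eq[OF assms(3)]
    unfolding P_def W_def r_def Ax_def Ay_def tri_area_eq nx_def a_def by simp
  have L': "single_layer_grad x y = P *\<^sub>R W"
    using single_layer_grad_eq[OF assms(3)]
    unfolding P_def W_def r_def Ax_def Ay_def tri_area_eq a_def by simp

  \<comment> \<open>\<open>Fx\<close> is minus the part of \<open>P *\<^sub>R W\<close> tangential
    to the first triangle.\<close>
  have Fx: "Fx = - (P *\<^sub>R (W - (nx \<bullet> W) *\<^sub>R nx))"
  proof -
    have "Fx = (2 * Ay) *\<^sub>R (J4 *\<^sub>R cross3 a1 nx + J5 *\<^sub>R cross3 (a2 - a1) nx - J6 *\<^sub>R cross3 a2 nx)"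
      unfolding Fx_def edge_normal_flux
      unfolding tri_edges nx_def[symmetric] a1_def[symmetric] a2_def[symmetric]
      by (simp add: scaleR_add_right scaleR_diff_right mult.assoc)
    also have "\<dots> = (2 * Ay) *\<^sub>R - ((2 * Ax) *\<^sub>R (W - (nx \<bullet> W) *\<^sub>R nx))"
      unfolding Ax[symmetric] by (subst edge_flux_eq_tangential[OF x0 nx W1 W2]) (rule refl)
    finally show ?thesis by (simp add: P_def mult_ac)
  qed
  have Fy: "Fy = P *\<^sub>R (W - (ny \<bullet> W) *\<^sub>R ny)"
  proof -
    \<comment> \<open>The edges of \<open>y\<close> are \<open>- a3\<close> and \<open>- a4\<close>,
      so the tangential formula is applied to \<open>- W\<close>; hence the sign of
      \<open>Fy\<close> is opposite to that of \<open>Fx\<close>.\<close>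
    have 3: "(- a3) \<bullet> (- W) = J3 - J2" and 4: "(- a4) \<bullet> (- W) = J1 - J2"
      by (simp_all add: W3 W4)
    have e: "y 2 - y 1 = - a3" "y 3 - y 1 = - a4" by (simp_all add: a_def)
    have "Fy = (2 * Ax) *\<^sub>R (J1 *\<^sub>R cross3 (- a3) ny + J2 *\<^sub>R cross3 (- a4 - - a3) ny - J3 *\<^sub>R cross3 (- a4) ny)"
      unfolding Fy_def edge_normal_flux
      unfolding tri_edges ny_def[symmetric] e
      by (simp add: scaleR_add_right scaleR_diff_right mult.assoc)
    also have "\<dots> = (2 * Ax) *\<^sub>R - ((2 * Ay) *\<^sub>R (- W - (ny \<bullet> - W) *\<^sub>R ny))"
      unfolding Ay[symmetric] by (subst edge_flux_eq_tangential[OF y0 ny 3 4]) (rule refl)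
    finally show ?thesis by (simp add: P_def mult_ac scaleR_diff_right)
  qed

  have "(nx \<bullet> ny)\<^sup>2 \<noteq> 1"
    using assms(4) unfolding nx_def ny_def by (auto simp: power2_eq_1_iff)
  then have c: "1 - (nx \<bullet> ny)\<^sup>2 \<noteq> 0" by simp
  \<comment> \<open>The unknowns are the two normal components of \<open>W\<close>; this combination
    eliminates \<open>ny \<bullet> W\<close>.\<close>
  have "nx \<bullet> Fy - (nx \<bullet> ny) * (ny \<bullet> Fx) = P * (nx \<bullet> W) * (1 - (nx \<bullet> ny)\<^sup>2)"
    by (simp add: Fx Fy inner_diff_right nxy inner_commute[of ny nx] algebra_simps power2_eq_square)
  then have goal1: "double_layer x y = - ((nx \<bullet> Fy - (nx \<bullet> ny) * (ny \<bullet> Fx)) / (1 - (nx \<bullet> ny)\<^sup>2))"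
    using c by (simp add: M)
  \<comment> \<open>\<open>- Fx\<close> supplies the tangential part of \<open>P *\<^sub>R W\<close>
    and \<open>- M *\<^sub>R nx\<close> the normal part.\<close>
  have goal2: "single_layer_grad x y = - Fx - double_layer x y *\<^sub>R nx"
    by (simp add: L' M Fx scaleR_diff_right)
  obtain s t u w where "e = s *\<^sub>R (x 2 - x 1) + t *\<^sub>R (x 3 - x 1) + u *\<^sub>R (y 2 - y 1) + w *\<^sub>R (y 3 - y 1)"
    using tri_normal_spanning[OF assms(1,2,4)] by blast
  then have "e = s *\<^sub>R a1 + t *\<^sub>R a2 + (- u) *\<^sub>R a3 + (- w) *\<^sub>R a4"
    by (simp add: a_def scaleR_diff_right)
  then have goal3: "\<exists>s10 s20 s30 s40. e = s10 *\<^sub>R a1 + s20 *\<^sub>R a2 + s30 *\<^sub>R a3 + s40 *\<^sub>R a4"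
    by blast
  have goal4: "single_layer x y = 4 * Ax * Ay / 3 *
                 (- s40 * J1 + (1 + s30 + s40) * J2 - s30 * J3
                  - s20 * J4 + (1 + s10 + s20) * J5 - s10 * J6)"
    if e: "e = s10 *\<^sub>R a1 + s20 *\<^sub>R a2 + s30 *\<^sub>R a3 + s40 *\<^sub>R a4" for s10 s20 s30 s40
  proof -
    \<comment> \<open>The coordinates of \<open>e\<close> turn \<open>e \<bullet> W\<close> into a
      combination of the four known fluxes, and \<open>WI\<close> then determines
      \<open>I\<close>.\<close>
    have "e \<bullet> W = s10 * (J6 - J5) + s20 * (J4 - J5) + s30 * (J3 - J2) + s40 * (J1 - J2)"
      by (subst e) (simp add: inner_add_left W1 W2 W3 W4)
    with WI have "I = (- s40 * J1 + (1 + s30 + s40) * J2 - s30 * J3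
                  - s20 * J4 + (1 + s10 + s20) * J5 - s10 * J6) / 3"
      by (simp add: algebra_simps)
    then show ?thesis by (simp add: L P_def)
  qed
  show ?thesis
    unfolding Let_def a_def[symmetric] J_def[symmetric]
      Ax_def[symmetric] Ay_def[symmetric] nx_def[symmetric] ny_def[symmetric]
      Fx_def[symmetric] Fy_def[symmetric]
    using goal1 goal2 goal3 goal4 by blast
qed

end
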